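(* Let $k$ be an odd natural number, $\alpha>0$, and let $v_\pm,u_\pm$ be real constants with $v_\pm>0$. Assume that $u_->u_+$. Consider the Riemann problem $$\begin{cases} v_t+(vu^k)_x=0,\\ (vu)_t+(vu^{k+1})_x=-\alpha vu,\end{cases}\qquad (v(x,0),u(x,0))=\begin{cases}(v_-,u_-),& x<0,\\ (v_+,u_+),& x>0.\end{cases}$$ This Riemann problem admits one and only one measure solution (delta shock wave solution) of the form $$(v(x,t),u(x,t))=\begin{cases}(v_-,u_-e^{-\alpha t}),& x<x(t),\\ (w(t)\,\delta(x-x(t)),\,u_\delta e^{-\alpha t}),& x=x(t),\\ (v_+,u_+e^{-\alpha t}),& x>x(t),\end{cases}$$ where $w(t)=\frac{w_0}{\alpha k}(1-e^{-\alpha kt})$, $x(t)=\frac{\sigma}{\alpha k}(1-e^{-\alpha kt})$, and the constants $\sigma,w_0,u_\delta$ are determined uniquely by the entropy condition $u_+^k<\sigma<u_-^k$ and $$\begin{cases}\sigma=u_\delta^k,\\ w_0=-\sigma(v_--v_+)+(v_-u_-^k-v_+u_+^k),\\ w_0u_\delta=-\sigma(v_-u_--v_+u_+)+(v_-u_-^{k+1}-v_+u_+^{k+1}).\end{cases}$$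
   Context: Weighted delta function: for a smooth curve $L=\{(x(s),t(s)): a<s<b\}$ and $w\in L^1((a,b))$, the distribution $w(s)\delta_L$ is defined by $\langle w\delta_L,\phi\rangle=\int_a^b w(s)\phi(x(s),t(s))\,ds$ for $\phi\in C_0^\infty(\mathbb{R}\times[0,\infty))$. For the solution in the claim, $L=\{(x(t),t):t>0\}$ is parametrized by $t$. Delta shock wave solution: a pair $(v,u)$ is a delta shock wave solution (in the sense of distributions) of the Riemann problem if there are a smooth curve $L$ and a function $w\in C^1(L)$ such that $v=\widetilde v(x,t)+w\delta_L$, $u=\widetilde u(x,t)$ with $\widetilde v,\widetilde u\in L^\infty(\mathbb{R}\times(0,\infty);\mathbb{R})$, and for all $\varphi\in C_0^\infty(\mathbb{R}\times(0,\infty))$ $$\langle v,\varphi_t\rangle+\langle vu^k,\varphi_x\rangle=0,\qquad \langle vu,\varphi_t\rangle+\langle vu^{k+1},\varphi_x\rangle=\langle\alpha vu,\varphi\rangle .$$ Here $u|_L$ is a prescribed function of $t$ (in the claim, $u|_L=u_\delta e^{-\alpha t}$), and $$\langle v,\varphi\rangle=\int_0^\infty\!\!\int_{\mathbb{R}}\widetilde v\varphi\,dx\,dt+\langle w\delta_L,\varphi\rangle,\qquad \langle vG(u),\varphi\rangle=\int_0^\infty\!\!\int_{\mathbb{R}}\widetilde vG(\widetilde u)\varphi\,dx\,dt+\langle w\,G(u|_L)\,\delta_L,\varphi\rangle .$$ In the displayed form of the solution, the first and third lines give $\widetilde v,\widetilde u$ off the curve, and the middle line gives the weight $w(t)$ of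 the delta function and the value $u|_L$ on the curve. *)

theory Defs
  imports "HOL-Analysis.Analysis"
begin

section \<open>Smooth functions and test functions\<close>

text \<open>
  Continuous differentiability of order \<open>n\<close> on an open set \<open>S\<close>, by recursion on the partial
  derivatives; \<open>smooth_on S f\<close> is \<open>C\<^sup>\<infinity>\<close>. Only meaningful for open \<open>S\<close>, since derivatives are taken
  in the whole space.
\<close>

primrec Ck_on :: "nat \<Rightarrow> 'a::euclidean_space set \<Rightarrow> ('a \<Rightarrow> real) \<Rightarrow> bool" where
  "Ck_on 0 S f \<longleftrightarrow> continuous_on S f"
| "Ck_on (Suc n) S f \<longleftrightarrow>
     (\<forall>z\<in>S. f differentiable (at z)) \<and>
     (\<forall>b\<in>Basis. Ck_on n S (\<lambda>z. frechet_derivative f (at z) b))"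

definition smooth_on :: "'a::euclidean_space set \<Rightarrow> ('a \<Rightarrow> real) \<Rightarrow> bool" where
  "smooth_on S f \<longleftrightarrow> (\<forall>n. Ck_on n S f)"

definition test_function :: "'a::euclidean_space set \<Rightarrow> ('a \<Rightarrow> real) \<Rightarrow> bool" where
  "test_function \<Omega> \<phi> \<longleftrightarrow>
     smooth_on UNIV \<phi> \<and> compact (closure {z. \<phi> z \<noteq> 0}) \<and> closure {z. \<phi> z \<noteq> 0} \<subseteq> \<Omega>"

text \<open>Points of the plane are pairs \<open>(x, t)\<close> of position and time.\<close>

abbreviation half_plane :: "(real \<times> real) set" where
  "half_plane \<equiv> UNIV \<times> {0<..}"

definition partial_x :: "(real \<times> real \<Rightarrow> real) \<Rightarrow> real \<times> real \<Rightarrow> real" where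
  "partial_x \<phi> z = frechet_derivative \<phi> (at z) (1, 0)"

definition partial_t :: "(real \<times> real \<Rightarrow> real) \<Rightarrow> real \<times> real \<Rightarrow> real" where
  "partial_t \<phi> z = frechet_derivative \<phi> (at z) (0, 1)"

definition essentially_bounded_on :: "(real \<times> real) set \<Rightarrow> (real \<times> real \<Rightarrow> real) \<Rightarrow> bool" where
  "essentially_bounded_on \<Omega> f \<longleftrightarrow>
     set_borel_measurable lborel \<Omega> f \<and> (\<exists>C. AE z in lborel. z \<in> \<Omega> \<longrightarrow> \<bar>f z\<bar> \<le> C)"


section \<open>Delta shock wave solutions\<close>

text \<open>
  The curve \<open>L = {(X t, t) | t > 0}\<close> is parametrized by time. The weight need only be
  integrable on compact subintervals of \<open>(0, \<infinity>)\<close>, as test functions vanish outside one.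
\<close>

definition weighted_delta ::
  "(real \<Rightarrow> real) \<Rightarrow> (real \<Rightarrow> real) \<Rightarrow> (real \<times> real \<Rightarrow> real) \<Rightarrow> real" where
  "weighted_delta X w \<phi> = (LINT t:{0<..}|lborel. w t * \<phi> (X t, t))"

text \<open>
  The pairing \<open>\<langle>v G(u), \<phi>\<rangle>\<close> for \<open>v = vr + w \<delta>\<^sub>L\<close>, where \<open>vr\<close>, \<open>ur\<close> are the regular parts of
  \<open>v\<close>, \<open>u\<close> and \<open>uL t\<close> is the prescribed value of \<open>u\<close> at \<open>(X t, t)\<close>. The case \<open>G = (\<lambda>_. 1)\<close>
  is \<open>\<langle>v, \<phi>\<rangle>\<close>.
\<close>

definition pairing ::
  "(real \<Rightarrow> real) \<Rightarrow> (real \<Rightarrow> real) \<Rightarrow> (real \<Rightarrow> real) \<Rightarrow>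
   (real \<times> real \<Rightarrow> real) \<Rightarrow> (real \<times> real \<Rightarrow> real) \<Rightarrow>
   (real \<Rightarrow> real) \<Rightarrow> (real \<times> real \<Rightarrow> real) \<Rightarrow> real" where
  "pairing X w uL vr ur G \<phi> =
     (LINT t:{0<..}|lborel. (LINT x|lborel. vr (x, t) * G (ur (x, t)) * \<phi> (x, t)))
     + weighted_delta X (\<lambda>t. w t * G (uL t)) \<phi>"

text \<open>
  The initial data are attained as \<open>t \<rightarrow> 0+\<close> in the sense of distributions on the real line;
  at time \<open>t\<close> the measure \<open>v\<close> has density \<open>vr (\<cdot>, t)\<close> and an atom of mass \<open>w t\<close> at \<open>X t\<close>.
\<close>

definition attains_initial_data ::
  "(real \<Rightarrow> real) \<Rightarrow> (real \<Rightarrow> real) \<Rightarrow>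
   (real \<times> real \<Rightarrow> real) \<Rightarrow> (real \<times> real \<Rightarrow> real) \<Rightarrow>
   (real \<Rightarrow> real) \<Rightarrow> (real \<Rightarrow> real) \<Rightarrow> bool" where
  "attains_initial_data X w vr ur v0 u0 \<longleftrightarrow>
     (\<forall>\<psi>. test_function UNIV \<psi> \<longrightarrow>
        ((\<lambda>t. (LINT x|lborel. vr (x, t) * \<psi> x) + w t * \<psi> (X t))
           \<longlongrightarrow> (LINT x|lborel. v0 x * \<psi> x)) (at_right 0) \<and>
        ((\<lambda>t. LINT x|lborel. ur (x, t) * \<psi> x)
           \<longlongrightarrow> (LINT x|lborel. u0 x * \<psi> x)) (at_right 0))"

text \<open>Continuity of \<open>uL\<close> ensures that all integrals over the curve converge.\<close>

definition delta_shock_solution ::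
  "nat \<Rightarrow> real \<Rightarrow> (real \<Rightarrow> real) \<Rightarrow> (real \<Rightarrow> real) \<Rightarrow>
   (real \<Rightarrow> real) \<Rightarrow> (real \<Rightarrow> real) \<Rightarrow> (real \<Rightarrow> real) \<Rightarrow>
   (real \<times> real \<Rightarrow> real) \<Rightarrow> (real \<times> real \<Rightarrow> real) \<Rightarrow> bool" where
  "delta_shock_solution k \<alpha> v0 u0 X w uL vr ur \<longleftrightarrow>
     smooth_on {0<..} X \<and> w C1_differentiable_on {0<..} \<and> continuous_on {0<..} uL \<and>
     essentially_bounded_on half_plane vr \<and> essentially_bounded_on half_plane ur \<and>
     (\<forall>\<phi>. test_function half_plane \<phi> \<longrightarrow>
        pairing X w uL vr ur (\<lambda>_. 1) (partial_t \<phi>)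
          + pairing X w uL vr ur (\<lambda>u. u ^ k) (partial_x \<phi>) = 0 \<and>
        pairing X w uL vr ur (\<lambda>u. u) (partial_t \<phi>)
          + pairing X w uL vr ur (\<lambda>u. u ^ (k + 1)) (partial_x \<phi>)
          = \<alpha> * pairing X w uL vr ur (\<lambda>u. u) \<phi>) \<and>
     attains_initial_data X w vr ur v0 u0"


section \<open>The Riemann problem and solutions consisting of one delta shock\<close>

definition riemann_data :: "real \<Rightarrow> real \<Rightarrow> real \<Rightarrow> real" where
  "riemann_data l r x = (if x < 0 then l else r)"

text \<open>The value assigned on the curve itself is irrelevant, the curve being a null set.\<close>

definition two_states ::
  "(real \<Rightarrow> real) \<Rightarrow> (real \<Rightarrow> real) \<Rightarrow> (real \<Rightarrow> real) \<Rightarrow> real \<times> real \<Rightarrow> real" where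
  "two_states X l r = (\<lambda>(x, t). if x < X t then l t else r t)"

definition single_delta_shock_solution ::
  "nat \<Rightarrow> real \<Rightarrow> real \<Rightarrow> real \<Rightarrow> real \<Rightarrow> real \<Rightarrow>
   (real \<Rightarrow> real) \<Rightarrow> (real \<Rightarrow> real) \<Rightarrow> real \<Rightarrow> bool" where
  "single_delta_shock_solution k \<alpha> vm vp um up X w ud \<longleftrightarrow>
     delta_shock_solution k \<alpha> (riemann_data vm vp) (riemann_data um up)
       X w (\<lambda>t. ud * exp (- \<alpha> * t))
       (two_states X (\<lambda>_. vm) (\<lambda>_. vp))
       (two_states X (\<lambda>t. um * exp (- \<alpha> * t)) (\<lambda>t. up * exp (- \<alpha> * t)))"

text \<open>
  Entropy condition for an arbitrary curve: the speed of the curve lies strictly between the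
  values of \<open>u\<^sup>k\<close> on its two sides. If \<open>X t = \<sigma> / (\<alpha> k) * (1 - exp (- \<alpha> k t))\<close>, then
  \<open>X' t = \<sigma> * exp (- \<alpha> k t)\<close> and the condition is \<open>up ^ k < \<sigma> < um ^ k\<close>.
\<close>

definition entropic_curve ::
  "nat \<Rightarrow> real \<Rightarrow> real \<Rightarrow> real \<Rightarrow> (real \<Rightarrow> real) \<Rightarrow> bool" where
  "entropic_curve k \<alpha> um up X \<longleftrightarrow>
     (\<forall>t>0. (up * exp (- \<alpha> * t)) ^ k < deriv X t \<and> deriv X t < (um * exp (- \<alpha> * t)) ^ k)"

definition entropic_rankine_hugoniot ::
  "nat \<Rightarrow> real \<Rightarrow> real \<Rightarrow> real \<Rightarrow> real \<Rightarrow> real \<Rightarrow> real \<Rightarrow> real \<Rightarrow> bool" where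
  "entropic_rankine_hugoniot k vm vp um up \<sigma> w0 ud \<longleftrightarrow>
     up ^ k < \<sigma> \<and> \<sigma> < um ^ k \<and>
     \<sigma> = ud ^ k \<and>
     w0 = - \<sigma> * (vm - vp) + (vm * um ^ k - vp * up ^ k) \<and>
     w0 * ud = - \<sigma> * (vm * um - vp * up) + (vm * um ^ (k + 1) - vp * up ^ (k + 1))"

text \<open>The profile \<open>c / (\<alpha> k) * (1 - exp (- \<alpha> k t))\<close>, shared by the curve and the weight.\<close>

definition damped_profile :: "nat \<Rightarrow> real \<Rightarrow> real \<Rightarrow> real \<Rightarrow> real" where
  "damped_profile k \<alpha> c t = c / (\<alpha> * real k) * (1 - exp (- \<alpha> * real k * t))"

end

theory Submission
  imports Defs
begin

text \<open>
  In the moving frame \<open>y = x - X t\<close> the weak form of each conservation law reduces, by Leibniz' rule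
  and the fundamental theorem of calculus, to an integral \<open>\<integral> A t * \<phi> (X t, t) + B t * \<phi>\<^sub>x (X t, t) dt\<close>
  over the curve, and testing with products of bump functions shows that it vanishes for all \<open>\<phi>\<close>
  iff \<open>A = B = 0\<close>. The coefficients \<open>B\<close> give \<open>w * (u\<^sub>L ^ k - X') = 0\<close>, the coefficients \<open>A\<close> the
  equations for \<open>w'\<close>. The initial data force \<open>X\<close> and \<open>w\<close> to vanish at \<open>t = 0+\<close>, and the entropy
  condition makes \<open>w' > 0\<close>, hence \<open>w > 0\<close>. Therefore \<open>X' t = ud ^ k * exp (- \<alpha> k t)\<close>, which determines
  \<open>X\<close> and \<open>w\<close>, and the remaining equation for \<open>ud\<close> has a unique root in \<open>(up, um)\<close> by monotonicity.
\<close>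

section \<open>Smooth bump functions\<close>

text \<open>In the moving frame the two sides of the curve become the fixed intervals
  \<open>{-R..0}\<close> and \<open>{0..R}\<close>, so Leibniz' rule gives no boundary terms and
  every jump arises from integrating \<open>partial_x \<phi>\<close> up to \<open>y = 0\<close>. Off
  the curve both conserved densities already satisfy \<open>l' = - \<beta> * l\<close>, with
  \<open>\<beta> = 0\<close> for mass and \<open>\<beta> = \<alpha>\<close> for momentum, so one
  balance identity serves both laws. The obstacle to uniqueness is that the equation from the
  coefficients \<open>B\<close> says nothing where \<open>w\<close> vanishes; this has to be
  excluded while the curve is still unknown. Here the entropy condition acts, because it turns
  \<open>w'\<close> into a sum of two positive terms. The limit of \<open>X\<close> at 0 has to be
  read off from \<open>u\<close>: the densities \<open>vm\<close> and \<open>vp\<close> may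
  coincide, whereas \<open>u\<close> always jumps and carries no atom. Once \<open>X'\<close> is
  known, all relations share the factor \<open>exp (- \<alpha> * real k * t)\<close>, and cancelling
  it leaves the equations for the constants.\<close>

lemma smooth_on_coinduct:
  fixes f :: "'a::euclidean_space \<Rightarrow> real"
  assumes "f \<in> F"
    and closed: "\<And>f. f \<in> F \<Longrightarrow> \<exists>f'. (\<forall>z. (f has_derivative f' z) (at z)) \<and> (\<forall>b\<in>Basis. (\<lambda>z. f' z b) \<in> F)"
  shows "smooth_on S f"
proof -
  \<comment> \<open>The induction on the order needs all partial derivatives at once, so it ranges
    over the whole family \<open>F\<close>.\<close>
  have "Ck_on n S f" if "f \<in> F" for n f
    using that
  proof (induction n arbitrary: f)
    case 0
    then show ?case
      using closed[OF 0] by (auto intro!: continuous_at_imp_continuous_on dest: has_derivative_continuous)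
  next
    case (Suc n)
    obtain f' where f': "\<And>z. (f has_derivative f' z) (at z)" "\<And>b. b \<in> Basis \<Longrightarrow> (\<lambda>z. f' z b) \<in> F"
      using closed[OF Suc.prems] by blast
    have "frechet_derivative f (at z) = f' z" for z
      using frechet_derivative_at[OF f'(1)[of z]] by simp
    then show ?case
      using f' Suc.IH by (auto simp: differentiable_def)
  qed
  then show ?thesis
    using assms(1) by (simp add: smooth_on_def)
qed

lemma smooth_on_real_coinduct:
  fixes f :: "real \<Rightarrow> real"
  assumes "f \<in> F"
    and closed: "\<And>f. f \<in> F \<Longrightarrow> \<exists>f'\<in>F. \<forall>x. (f has_real_derivative f' x) (at x)"
  shows "smooth_on S f"
proof (rule smooth_on_coinduct[OF assms(1)])
  fix f assume "f \<in> F"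
  then obtain f' where "f' \<in> F" "\<forall>x. (f has_real_derivative f' x) (at x)"
    using closed by blast
  then show "\<exists>f'. (\<forall>z. (f has_derivative f' z) (at z)) \<and> (\<forall>b\<in>Basis. (\<lambda>z. f' z b) \<in> F)"
    by (intro exI[of _ "\<lambda>z h. f' z * h"]) (auto simp: has_field_derivative_def)
qed

text \<open>A partial derivative of a product \<open>a (x) * b (t)\<close> differentiates one factor
  and keeps the other, so products of members of \<open>F\<close> again form a family closed under
  partial derivatives.\<close>

lemma smooth_on_tensor:
  fixes a b :: "real \<Rightarrow> real"
  assumes "a \<in> F" "b \<in> F"
    and closed: "\<And>f. f \<in> F \<Longrightarrow> \<exists>f'\<in>F. \<forall>x. (f has_real_derivative f' x) (at x)"
  shows "smooth_on S (\<lambda>z. a (fst z) * b (snd z))"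
proof -
  define T where "T = {\<lambda>z. a (fst z) * b (snd z) |a b. a \<in> F \<and> b \<in> F}"
  have T: "(\<lambda>z. a (fst z) * b (snd z)) \<in> T" if "a \<in> F" "b \<in> F" for a b
    using that unfolding T_def by blast
  show ?thesis
  proof (rule smooth_on_coinduct[where F = T])
    fix f assume "f \<in> T"
    then obtain a b where f: "f = (\<lambda>z. a (fst z) * b (snd z))" and ab: "a \<in> F" "b \<in> F"
      unfolding T_def by blast
    obtain a' b' where F': "a' \<in> F" "b' \<in> F"
      and a': "\<And>x. (a has_real_derivative a' x) (at x)" and b': "\<And>x. (b has_real_derivative b' x) (at x)"
      using closed[OF ab(1)] closed[OF ab(2)] by blast
    have "(f has_derivative (\<lambda>h. a (fst z) * (b' (snd z) * snd h) + a' (fst z) * fst h * b (snd z))) (at z)" for z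
      unfolding f
      by (rule has_derivative_mult
          has_derivative_compose[OF has_derivative_fst[OF has_derivative_ident] a'[unfolded has_field_derivative_def]]
          has_derivative_compose[OF has_derivative_snd[OF has_derivative_ident] b'[unfolded has_field_derivative_def]])+
    moreover have "(\<lambda>z. a (fst z) * (b' (snd z) * snd h) + a' (fst z) * fst h * b (snd z)) \<in> T" if "h \<in> Basis" for h
      using that T[OF ab(1) F'(2)] T[OF F'(1) ab(2)] by (auto simp: Basis_prod_def)
    ultimately show "\<exists>f'. (\<forall>z. (f has_derivative f' z) (at z)) \<and> (\<forall>h\<in>Basis. (\<lambda>z. f' z h) \<in> T)"
      by (intro exI[of _ "\<lambda>z h. a (fst z) * (b' (snd z) * snd h) + a' (fst z) * fst h * b (snd z)"]) auto
  qed (use T assms in blast)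
qed

text \<open>Closed under differentiation, since \<open>h = 1 / (1 - x\<^sup>2)\<close> satisfies \<open>h' = 2 x h\<^sup>2\<close>.\<close>
definition bump_family :: "real poly \<Rightarrow> nat \<Rightarrow> real \<Rightarrow> real" where
  "bump_family p n x =
     (if \<bar>x\<bar> < 1 then poly p x * (1 / (1 - x\<^sup>2)) ^ n * exp (- (1 / (1 - x\<^sup>2))) else 0)"

text \<open>Quadratic vanishing at the endpoints and beyond is what makes the derivative exist and
  be 0 there. With \<open>h = 1 / (1 - x\<^sup>2)\<close>, the factor \<open>exp (- h)\<close> beats
  every power of \<open>h\<close>: two powers more than \<open>n\<close> pay for
  \<open>(1 - x\<^sup>2)\<^sup>2\<close>, which is at most
  \<open>4 * (x - x0)\<^sup>2\<close>.\<close>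

lemma bump_family_bound:
  "\<exists>C\<ge>0. \<forall>x x0. 1 \<le> \<bar>x0\<bar> \<longrightarrow> \<bar>bump_family p n x\<bar> \<le> C * (x - x0)\<^sup>2"
proof -
  have "bounded (poly p ` {-1..1})"
    by (intro compact_imp_bounded compact_continuous_image continuous_intros compact_Icc)
  then obtain M where "\<forall>x\<in>{-1..1}. \<bar>poly p x\<bar> \<le> M"
    by (auto simp: bounded_iff)
  then have M: "\<bar>poly p x\<bar> \<le> M" if "\<bar>x\<bar> \<le> 1" for x
    using that by (auto simp: abs_le_iff)
  have "0 \<le> M" using M[of 0] by auto
  have "\<bar>bump_family p n x\<bar> \<le> 4 * M * fact (n + 2) * (x - x0)\<^sup>2" if x0: "1 \<le> \<bar>x0\<bar>" for x x0
  proof (cases "\<bar>x\<bar> < 1")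
    case True
    define h where "h = 1 / (1 - x\<^sup>2)"
    have pos: "0 < 1 - x\<^sup>2" using True by (simp add: abs_square_less_1)
    then have h: "0 < h" "h * (1 - x\<^sup>2) = 1" by (auto simp: h_def)
    have "h ^ m * exp (- h) \<le> fact m" for m
    proof -
      \<comment> \<open>A single term of the exponential series is at most the whole series, since
        \<open>h\<close> is positive.\<close>
      have "(\<Sum>i\<in>{m}. inverse (fact i) * h ^ i) \<le> (\<Sum>i. inverse (fact i) * h ^ i)"
        using h(1) by (intro sum_le_suminf summable_exp) auto
      also have "\<dots> = exp h"
        by (simp add: exp_def)
      finally show ?thesis
        by (simp add: exp_minus field_simps)
    qed
    note this[of "n + 2"]
    then have "h ^ (n + 2) * exp (- h) * (1 - x\<^sup>2)\<^sup>2 \<le> fact (n + 2) * (1 - x\<^sup>2)\<^sup>2"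
      by (rule mult_right_mono) simp
    moreover have "h ^ (n + 2) * exp (- h) * (1 - x\<^sup>2)\<^sup>2 = h ^ n * exp (- h) * (h * (1 - x\<^sup>2))\<^sup>2"
      by (simp add: power_add power_mult_distrib power2_eq_square)
    ultimately have 1: "h ^ n * exp (- h) \<le> fact (n + 2) * (1 - x\<^sup>2)\<^sup>2"
      by (simp only: h(2) power_one mult_1_right)
    have "1 - x\<^sup>2 = (1 - \<bar>x\<bar>) * (1 + \<bar>x\<bar>)"
      by (simp add: algebra_simps power2_eq_square)
    \<comment> \<open>From \<open>\<bar>x\<bar> < 1 \<le> \<bar>x0\<bar>\<close> follows \<open>1 -
      \<bar>x\<bar> \<le> \<bar>x0\<bar> - \<bar>x\<bar> \<le> \<bar>x - x0\<bar>\<close>.\<close>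
    also have "\<dots> \<le> \<bar>x - x0\<bar> * 2"
      using True x0 by (intro mult_mono) auto
    finally have "(1 - x\<^sup>2)\<^sup>2 \<le> (\<bar>x - x0\<bar> * 2)\<^sup>2"
      using pos by (intro power_mono) auto
    then have 2: "(1 - x\<^sup>2)\<^sup>2 \<le> 4 * (x - x0)\<^sup>2"
      by (simp add: power_mult_distrib)
    have "\<bar>bump_family p n x\<bar> = \<bar>poly p x\<bar> * (h ^ n * exp (- h))"
      using True h by (simp add: bump_family_def h_def abs_mult)
    also have "\<dots> \<le> M * (fact (n + 2) * (4 * (x - x0)\<^sup>2))"
      using M[of x] True 1 2 h(1) \<open>0 \<le> M\<close>
      by (intro mult_mono order_trans[OF 1] mult_left_mono) auto
    finally show ?thesis by (simp only: mult_ac)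
  qed (use \<open>0 \<le> M\<close> in \<open>simp add: bump_family_def\<close>)
  then show ?thesis
    using \<open>0 \<le> M\<close> by (intro exI[of _ "4 * M * fact (n + 2)"]) auto
qed

lemma bump_family_deriv:
  "\<exists>q. \<forall>x. (bump_family p n has_real_derivative bump_family q (n + 2) x) (at x)"
proof -
  \<comment> \<open>Here \<open>[:1, 0, -1:]\<close> is \<open>1 - x\<^sup>2\<close> and
    \<open>pCons 0 p\<close> is \<open>x * p\<close>. The product rule yields the powers
    \<open>h ^ n\<close>, \<open>h ^ (n + 1)\<close> and \<open>h ^ (n + 2)\<close>; the factors
    \<open>1 - x\<^sup>2\<close>, inverse to \<open>h\<close>, raise all of them to
    \<open>n + 2\<close>.\<close>
  define q where "q = pderiv p * [:1, 0, -1:] ^ 2 + smult (2 * real n) (pCons 0 p * [:1, 0, -1:]) - smult 2 (pCons 0 p)"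
  have "(bump_family p n has_real_derivative bump_family q (n + 2) x) (at x)" for x
  proof (cases "\<bar>x\<bar> < 1")
    case True
    define h where "h = 1 / (1 - x\<^sup>2)"
    have pos: "0 < 1 - x\<^sup>2" using True by (simp add: abs_square_less_1)
    then have h: "h * (1 - x\<^sup>2) = 1" by (auto simp: h_def)
    have dh: "((\<lambda>x. 1 / (1 - x\<^sup>2)) has_real_derivative 2 * x * h\<^sup>2) (at x)"
      using pos by (auto intro!: derivative_eq_intros simp: h_def power2_eq_square)
    have d0: "((\<lambda>x. poly p x * (1 / (1 - x\<^sup>2)) ^ n * exp (- (1 / (1 - x\<^sup>2)))) has_real_derivative
        (poly p x * (real n * (2 * x * h\<^sup>2 * h ^ (n - 1))) + poly (pderiv p) x * h ^ n) * exp (- h)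
          + exp (- h) * (- (2 * x * h\<^sup>2)) * (poly p x * h ^ n)) (at x)"
      by (rule derivative_eq_intros dh poly_DERIV refl | simp add: h_def)+
    \<comment> \<open>For \<open>n = 0\<close> the exponent \<open>n - 1\<close> is truncated to 0,
      and only the factor \<open>real n\<close> saves the identity.\<close>
    have nh: "real n * (h\<^sup>2 * h ^ (n - 1)) = real n * h ^ (n + 1)"
      by (cases n) (auto simp: power2_eq_square)
    have "(poly p x * (real n * (2 * x * h\<^sup>2 * h ^ (n - 1))) + poly (pderiv p) x * h ^ n) * exp (- h)
          + exp (- h) * (- (2 * x * h\<^sup>2)) * (poly p x * h ^ n)
        = (2 * x * poly p x * (real n * (h\<^sup>2 * h ^ (n - 1))) + poly (pderiv p) x * h ^ n - 2 * x * poly p x * h ^ (n + 2)) * exp (- h)"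
      by (simp add: algebra_simps power2_eq_square)
    also have "\<dots> = (2 * x * poly p x * (real n * h ^ (n + 1)) + poly (pderiv p) x * h ^ n - 2 * x * poly p x * h ^ (n + 2)) * exp (- h)"
      unfolding nh ..
    also have "\<dots> = (2 * x * poly p x * (real n * h ^ (n + 1)) * (h * (1 - x\<^sup>2)) + poly (pderiv p) x * h ^ n * (h * (1 - x\<^sup>2))\<^sup>2
        - 2 * x * poly p x * h ^ (n + 2)) * exp (- h)"
      by (simp add: h)
    also have "\<dots> = poly q x * h ^ (n + 2) * exp (- h)"
      by (simp add: q_def algebra_simps power2_eq_square)
    finally have "(poly p x * (real n * (2 * x * h\<^sup>2 * h ^ (n - 1))) + poly (pderiv p) x * h ^ n) * exp (- h)
          + exp (- h) * (- (2 * x * h\<^sup>2)) * (poly p x * h ^ n) = bump_family q (n + 2) x"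
      using True by (simp add: bump_family_def h_def)
    from DERIV_cong[OF d0 this] have d: "((\<lambda>x. poly p x * (1 / (1 - x\<^sup>2)) ^ n * exp (- (1 / (1 - x\<^sup>2)))) has_real_derivative
        bump_family q (n + 2) x) (at x)" .
    have "open {x::real. \<bar>x\<bar> < 1}"
      by (intro open_Collect_less continuous_intros)
    then show ?thesis
      using d True
      by (intro has_field_derivative_transform_within_open[OF d, of "{x. \<bar>x\<bar> < 1}"])
         (auto simp: bump_family_def)
  next
    case False
    \<comment> \<open>This case covers the endpoints as well as the exterior: the difference
      quotient at \<open>x\<close> is bounded by \<open>C * \<bar>y - x\<bar>\<close>.\<close>
    obtain C where C: "0 \<le> C" "\<And>y. \<bar>bump_family p n y\<bar> \<le> C * (y - x)\<^sup>2"
      using bump_family_bound[of p n] False by force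
    have "((\<lambda>y. C * \<bar>y - x\<bar>) \<longlongrightarrow> C * \<bar>x - x\<bar>) (at x)"
      by (intro tendsto_intros)
    then have lim: "((\<lambda>y. C * \<bar>y - x\<bar>) \<longlongrightarrow> 0) (at x)" by simp
    have "norm ((bump_family p n y - bump_family p n x) / (y - x)) \<le> C * \<bar>y - x\<bar>" if "y \<noteq> x" for y
    proof -
      have "\<bar>bump_family p n y\<bar> / \<bar>y - x\<bar> \<le> C * (y - x)\<^sup>2 / \<bar>y - x\<bar>"
        using C(2) by (intro divide_right_mono) auto
      also have "C * (y - x)\<^sup>2 = C * \<bar>y - x\<bar> * \<bar>y - x\<bar>"
        by (simp add: power2_eq_square)
      also have "\<dots> / \<bar>y - x\<bar> = C * \<bar>y - x\<bar>"
        using that by (intro nonzero_mult_div_cancel_right) simp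
      finally have "\<bar>bump_family p n y\<bar> / \<bar>y - x\<bar> \<le> C * \<bar>y - x\<bar>" .
      moreover have "bump_family p n x = 0"
        using False by (simp add: bump_family_def)
      ultimately show ?thesis
        by (simp only: diff_zero real_norm_def abs_divide)
    qed
    then have "\<forall>\<^sub>F y in at x. norm ((bump_family p n y - bump_family p n x) / (y - x)) \<le> C * \<bar>y - x\<bar>"
      unfolding eventually_at_filter by (intro always_eventually allI impI)
    from Lim_null_comparison[OF this lim]
    have "((\<lambda>y. (bump_family p n y - bump_family p n x) / (y - x)) \<longlongrightarrow> 0) (at x)" .
    moreover have "bump_family q (n + 2) x = 0"
      using False by (simp add: bump_family_def)
    ultimately show ?thesis
      by (simp add: has_field_derivative_iff)
  qed
  then show ?thesis by blast
qed

text \<open>The standard mollifier \<open>exp (- 1 / (1 - y\<^sup>2))\<close> in the variable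
  \<open>y = (x - c) / d\<close>, with centre \<open>c\<close> and, for positive \<open>d\<close>,
  radius \<open>d\<close>.\<close>

definition bump :: "real \<Rightarrow> real \<Rightarrow> real \<Rightarrow> real" where
  "bump c d x = bump_family 1 0 ((x - c) / d)"

definition bump_space :: "(real \<Rightarrow> real) set" where
  "bump_space = {\<lambda>x. bump_family p n ((x - c) / d) |p n c d. True}"

lemma bump_in_bump_space: "bump c d \<in> bump_space"
  unfolding bump_space_def bump_def[abs_def] by blast

lemma bump_space_deriv:
  assumes "f \<in> bump_space"
  shows "\<exists>f'\<in>bump_space. \<forall>x. (f has_real_derivative f' x) (at x)"
proof -
  obtain p n c d where f: "f = (\<lambda>x. bump_family p n ((x - c) / d))"
    using assms by (auto simp: bump_space_def)
  obtain q where q: "\<And>x. (bump_family p n has_real_derivative bump_family q (n + 2) x) (at x)"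
    using bump_family_deriv by blast
  \<comment> \<open>The inner derivative \<open>1 / d\<close> is absorbed into the polynomial, so
    the family stays closed. For \<open>d = 0\<close> the function is constant and
    \<open>1 / d = 0\<close> gives the right derivative.\<close>
  have "(f has_real_derivative bump_family (smult (1 / d) q) (n + 2) ((x - c) / d)) (at x)" for x
  proof -
    have "((\<lambda>x. (x - c) / d) has_real_derivative 1 / d) (at x)"
      by (rule DERIV_cdivide) (auto intro!: derivative_eq_intros)
    from DERIV_chain2[OF q this]
    have "(f has_real_derivative bump_family q (n + 2) ((x - c) / d) * (1 / d)) (at x)"
      by (simp add: f)
    moreover have "bump_family (smult r q) m y = bump_family q m y * r" for r m y
      by (simp add: bump_family_def)
    ultimately show ?thesis by simp
  qed
  moreover have "(\<lambda>x. bump_family (smult (1 / d) q) (n + 2) ((x - c) / d)) \<in> bump_space"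
    unfolding bump_space_def by blast
  ultimately show ?thesis
    by (intro bexI[where x = "\<lambda>x. bump_family (smult (1 / d) q) (n + 2) ((x - c) / d)"] allI)
qed

lemma bump_pos_iff: "0 < d \<Longrightarrow> 0 < bump c d x \<longleftrightarrow> \<bar>x - c\<bar> < d"
  by (simp add: bump_def bump_family_def)

lemma bump_eq_0: "0 < d \<Longrightarrow> d \<le> \<bar>x - c\<bar> \<Longrightarrow> bump c d x = 0"
  by (simp add: bump_def bump_family_def)

lemma bump_nonneg: "0 \<le> bump c d x"
  by (simp add: bump_def bump_family_def)

text \<open>The explicit slope shows that it vanishes at the centre but not elsewhere inside the
  support; this later separates the coefficients of \<open>\<phi>\<close> and
  \<open>partial_x \<phi>\<close> on the curve.\<close>

lemma bump_has_deriv: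
  assumes "\<bar>x - c\<bar> < d"
  defines "y \<equiv> (x - c) / d"
  shows "(bump c d has_real_derivative - 2 * y * (1 / (1 - y\<^sup>2))\<^sup>2 * bump c d x / d) (at x)"
proof -
  have d: "0 < d" using assms by simp
  have y: "\<bar>y\<bar> < 1" using assms d by (simp add: y_def)
  then have pos: "0 < 1 - y\<^sup>2" by (simp add: abs_square_less_1)
  have 1: "((\<lambda>y. exp (- (1 / (1 - y\<^sup>2)))) has_real_derivative
      - 2 * y * (1 / (1 - y\<^sup>2))\<^sup>2 * exp (- (1 / (1 - y\<^sup>2)))) (at y)"
    using pos by (auto intro!: derivative_eq_intros simp: power2_eq_square)
  have 2: "((\<lambda>x. (x - c) / d) has_real_derivative 1 / d) (at x)"
    by (rule DERIV_cdivide) (auto intro!: derivative_eq_intros)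
  have D: "((\<lambda>x. exp (- (1 / (1 - ((x - c) / d)\<^sup>2)))) has_real_derivative
      - 2 * y * (1 / (1 - y\<^sup>2))\<^sup>2 * exp (- (1 / (1 - y\<^sup>2))) * (1 / d)) (at x)"
    using DERIV_chain2[OF 1[unfolded y_def] 2] unfolding y_def .
  have eq: "bump c d z = exp (- (1 / (1 - ((z - c) / d)\<^sup>2)))" if "\<bar>z - c\<bar> < d" for z
    using that d by (simp add: bump_def bump_family_def)
  have "open {x. \<bar>x - c\<bar> < d}"
    by (intro open_Collect_less continuous_intros)
  then have "(bump c d has_real_derivative - 2 * y * (1 / (1 - y\<^sup>2))\<^sup>2 * exp (- (1 / (1 - y\<^sup>2))) * (1 / d)) (at x)"
    using assms(1) eq
    by (intro has_field_derivative_transform_within_open[OF D, of "{x. \<bar>x - c\<bar> < d}"]) simp_all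
  then show ?thesis
    using eq[OF assms(1)] by (simp add: y_def)
qed

lemma continuous_bump: "continuous_on S (bump c d)"
  using bump_space_deriv[OF bump_in_bump_space, of c d]
  by (auto intro!: continuous_at_imp_continuous_on DERIV_isCont)

lemma test_function_bump:
  assumes "0 < d"
  shows "test_function UNIV (bump c d)"
proof -
  have "{x. bump c d x \<noteq> 0} \<subseteq> {c - d..c + d}"
  proof
    fix x
    assume "x \<in> {x. bump c d x \<noteq> 0}"
    then have "\<not> d \<le> \<bar>x - c\<bar>"
      using bump_eq_0 assms by auto
    then show "x \<in> {c - d..c + d}" by auto
  qed
  then have "bounded {x. bump c d x \<noteq> 0}"
    by (rule bounded_subset[OF bounded_closed_interval])
  moreover have "smooth_on UNIV (bump c d)"
    using smooth_on_real_coinduct[OF bump_in_bump_space bump_space_deriv] .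
  ultimately show ?thesis
    unfolding test_function_def compact_closure by (intro conjI subset_UNIV)
qed

lemma test_function_bump_tensor:
  assumes "0 < d" "0 < e" "e < t"
  shows "test_function half_plane (\<lambda>z. bump c d (fst z) * bump t e (snd z))"
proof -
  have sub: "{z. bump c d (fst z) * bump t e (snd z) \<noteq> 0} \<subseteq> {c - d..c + d} \<times> {t - e..t + e}"
  proof
    fix z
    assume "z \<in> {z. bump c d (fst z) * bump t e (snd z) \<noteq> 0}"
    then have "\<not> d \<le> \<bar>fst z - c\<bar>" "\<not> e \<le> \<bar>snd z - t\<bar>"
      using bump_eq_0 assms by auto
    then show "z \<in> {c - d..c + d} \<times> {t - e..t + e}"
      by (cases z) auto
  qed
  then have "bounded {z. bump c d (fst z) * bump t e (snd z) \<noteq> 0}"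
    by (rule bounded_subset[OF bounded_Times[OF bounded_closed_interval bounded_closed_interval]])
  moreover have "closure {z. bump c d (fst z) * bump t e (snd z) \<noteq> 0} \<subseteq> {c - d..c + d} \<times> {t - e..t + e}"
    by (intro closure_minimal sub closed_Times closed_atLeastAtMost)
  then have "closure {z. bump c d (fst z) * bump t e (snd z) \<noteq> 0} \<subseteq> half_plane"
    by (rule order_trans) (use assms in auto)
  moreover have "smooth_on UNIV (\<lambda>z. bump c d (fst z) * bump t e (snd z))"
    using smooth_on_tensor[OF bump_in_bump_space bump_in_bump_space bump_space_deriv] .
  ultimately show ?thesis
    unfolding test_function_def compact_closure by (intro conjI)
qed

section \<open>Integrals of compactly supported functions\<close>

text \<open>Passage from the Lebesgue integrals of the definitions to the gauge integrals for which
  Leibniz' rule and the fundamental theorem are used. Positivity of \<open>a\<close> keeps the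
  interval inside the domain of continuity.\<close>

lemma LINT_positive_axis:
  fixes h :: "real \<Rightarrow> real"
  assumes "continuous_on {0<..} h" "0 < a" and "\<And>t. 0 < t \<Longrightarrow> \<not> (a < t \<and> t < b) \<Longrightarrow> h t = 0"
  shows "(LINT t:{0<..}|lborel. h t) = integral {a..b} h"
proof -
  have "(LINT t:{0<..}|lborel. h t) = (LINT t:{a..b}|lborel. h t)"
    unfolding set_lebesgue_integral_def
    by (intro Bochner_Integration.integral_cong) (use assms(2,3) in \<open>auto simp: indicator_def\<close>)
  also have "\<dots> = integral {a..b} h"
    using assms(2) by (intro set_borel_integral_eq_integral borel_integrable_atLeastAtMost'
      continuous_on_subset[OF assms(1)]) auto
  finally show ?thesis .
qed

lemma integrable_compact_support:
  fixes f :: "real \<Rightarrow> real"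
  assumes "continuous_on UNIV f" and "\<And>x. R < \<bar>x\<bar> \<Longrightarrow> f x = 0"
  shows "integrable lborel f"
proof -
  have "set_integrable lborel {-R..R} f"
    by (intro borel_integrable_atLeastAtMost' continuous_on_subset[OF assms(1)]) auto
  moreover have "(\<lambda>x. indicator {-R..R} x *\<^sub>R f x) = f"
    using assms(2) by (force simp: indicator_def fun_eq_iff)
  ultimately show ?thesis by (simp add: set_integrable_def)
qed

text \<open>Written as a full integral plus the jump times the integral up to \<open>c\<close>, so
  that the position \<open>c\<close> enters through the second integral alone.\<close>

lemma LINT_step:
  fixes f :: "real \<Rightarrow> real"
  assumes "continuous_on UNIV f" and "\<And>x. R < \<bar>x\<bar> \<Longrightarrow> f x = 0"
  shows "(LINT x|lborel. (if x < c then l else r) * f x)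
    = r * (LINT x|lborel. f x) + (l - r) * (LINT x:{..<c}|lborel. f x)"
proof -
  have int: "integrable lborel f"
    by (rule integrable_compact_support) (fact assms)+
  have "(LINT x|lborel. (if x < c then l else r) * f x)
      = (LINT x|lborel. r * f x + (l - r) * (indicator {..<c} x *\<^sub>R f x))"
    by (intro Bochner_Integration.integral_cong) (auto simp: indicator_def algebra_simps)
  also have "\<dots> = r * (LINT x|lborel. f x) + (l - r) * (LINT x:{..<c}|lborel. f x)"
    using int integrable_mult_indicator[OF _ int, of "{..<c}"]
    unfolding set_lebesgue_integral_def by (subst Bochner_Integration.integral_add) auto
  finally show ?thesis .
qed

lemma LINT_lessThan:
  fixes f :: "real \<Rightarrow> real"
  assumes "continuous_on UNIV f" and "\<And>x. R < \<bar>x\<bar> \<Longrightarrow> f x = 0"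
  shows "(LINT x:{..<c}|lborel. f x) = integral {-R..c} f"
proof -
  have cont: "continuous_on S f" for S
    using assms(1) continuous_on_subset by blast
  have "(LINT x:{..<c}|lborel. f x) = (LINT x:{-R..c}|lborel. f x)"
    unfolding set_lebesgue_integral_def
  proof (rule integral_cong_AE)
    \<comment> \<open>The two sets differ at the single point \<open>c\<close>, a null set, and
      where \<open>f\<close> is 0 anyway.\<close>
    show "AE x in lborel. indicat_real {..<c} x *\<^sub>R f x = indicat_real {-R..c} x *\<^sub>R f x"
      using AE_lborel_singleton[of c] by eventually_elim (use assms(2) in \<open>force simp: indicator_def\<close>)
  qed (use borel_measurable_continuous_onI[OF assms(1)] in measurable)
  also have "\<dots> = integral {-R..c} f"
    by (intro set_borel_integral_eq_integral borel_integrable_atLeastAtMost' cont)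
  finally show ?thesis .
qed

lemma LINT_compact_support:
  fixes f :: "real \<Rightarrow> real"
  assumes "continuous_on UNIV f" and "\<And>x. R < \<bar>x\<bar> \<Longrightarrow> f x = 0"
  shows "(LINT x|lborel. f x) = integral {-R..R} f"
proof -
  have "(LINT x|lborel. f x) = (LINT x:{-R..R}|lborel. f x)"
    unfolding set_lebesgue_integral_def
    by (intro Bochner_Integration.integral_cong) (use assms(2) in \<open>force simp: indicator_def\<close>)+
  also have "\<dots> = integral {-R..R} f"
    by (intro set_borel_integral_eq_integral borel_integrable_atLeastAtMost'
        continuous_on_subset[OF assms(1)]) auto
  finally show ?thesis .
qed

lemma LINT_step_centred:
  fixes f :: "real \<Rightarrow> real"
  assumes "continuous_on UNIV f" and "\<And>x. R < \<bar>x\<bar> \<Longrightarrow> f x = 0" and "0 \<le> R"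
  shows "(LINT x|lborel. (if x < 0 then l else r) * f x) = l * integral {-R..0} f + r * integral {0..R} f"
proof -
  have "f integrable_on {-R..R}"
    using assms(1) continuous_on_subset by (intro integrable_continuous_interval) blast
  then have "integral {-R..R} f = integral {-R..0} f + integral {0..R} f"
    using assms(3) by (intro Henstock_Kurzweil_Integration.integral_combine[symmetric]) auto
  moreover have "(LINT x|lborel. (if x < 0 then l else r) * f x)
      = r * (LINT x|lborel. f x) + (l - r) * (LINT x:{..<0}|lborel. f x)"
    by (rule LINT_step) (fact assms(1,2))+
  moreover have "(LINT x:{..<0}|lborel. f x) = integral {-R..0} f"
    by (rule LINT_lessThan) (fact assms(1,2))+
  moreover have "(LINT x|lborel. f x) = integral {-R..R} f"
    by (rule LINT_compact_support) (fact assms(1,2))+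
  ultimately show ?thesis
    by (simp add: algebra_simps)
qed

lemma LINT_translate:
  fixes f :: "real \<Rightarrow> real"
  shows "(LINT x|lborel. f x) = (LINT y|lborel. f (c + y))"
  using lborel_integral_real_affine[of 1 f c] by simp

text \<open>The fundamental lemma of the calculus of variations on the positive axis, with bumps as
  the only test functions.\<close>

lemma bump_test_imp_zero:
  fixes g :: "real \<Rightarrow> real"
  assumes cont: "continuous_on {0<..} g"
    and test: "\<And>t e. 0 < e \<Longrightarrow> e < t \<Longrightarrow> (LINT s:{0<..}|lborel. g s * bump t e s) = 0"
    and "0 < t"
  shows "g t = 0"
proof (rule ccontr)
  assume "g t \<noteq> 0"
  have "isCont g t"
    using cont \<open>0 < t\<close> by (simp add: continuous_on_eq_continuous_at)
  \<comment> \<open>Multiplying by \<open>g t\<close> treats both signs at once: the product is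
    positive near \<open>t\<close>.\<close>
  then have "((\<lambda>s. g t * g s) \<longlongrightarrow> g t * g t) (at t)"
    by (intro tendsto_intros) (simp add: isCont_def)
  moreover have "0 < g t * g t" using \<open>g t \<noteq> 0\<close> by (simp add: zero_less_mult_iff) linarith
  ultimately have "\<forall>\<^sub>F s in at t. 0 < g t * g s"
    by (rule order_tendstoD)
  then obtain d where d: "0 < d" "\<And>s. s \<noteq> t \<Longrightarrow> dist s t < d \<Longrightarrow> 0 < g t * g s"
    by (auto simp: eventually_at)
  \<comment> \<open>Small enough for the support to stay in the neighbourhood just found and inside
    the positive axis.\<close>
  define e where "e = min d t / 2"
  have e: "0 < e" "e < d" "e < t" using d(1) \<open>0 < t\<close> by (auto simp: e_def)
  define f where "f s = g t * (g s * bump t e s)" for s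
  have contf: "continuous_on {0<..} f"
    unfolding f_def by (intro continuous_intros cont continuous_bump)
  have "integral {t-e..t+e} f = (LINT s:{0<..}|lborel. f s)"
    using e by (intro LINT_positive_axis[symmetric] contf) (auto simp: f_def intro!: bump_eq_0)
  also have "\<dots> = 0"
    using test[OF e(1,3)] by (simp add: f_def)
  finally have "integral {t-e..t+e} f = 0" .
  moreover have "0 \<le> f s" if "s \<in> {t-e..t+e}" for s
  proof (cases "s = t")
    case False
    then have "0 < g t * g s" using d(2)[of s] that e by (auto simp: dist_real_def)
    then show ?thesis using bump_nonneg[of t e s] by (simp add: f_def mult.assoc[symmetric])
  qed (simp add: f_def bump_nonneg mult.assoc[symmetric])
  moreover have "continuous_on {t-e..t+e} f"
    by (rule continuous_on_subset[OF contf]) (use e in auto)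
  ultimately have "f t = 0"
    using integral_eq_0_iff[of "t-e" "t+e" f] e by auto
  moreover have "0 < bump t e t" using bump_pos_iff[OF e(1), of t t] e by simp
  ultimately show False using \<open>g t \<noteq> 0\<close> by (simp add: f_def)
qed

lemma test_functionD:
  assumes "test_function half_plane \<phi>"
  obtains a b R where "0 < a" "a < b" "0 < R"
    and "\<And>z. (\<phi> has_derivative frechet_derivative \<phi> (at z)) (at z)"
    and "continuous_on UNIV \<phi>" "continuous_on UNIV (partial_x \<phi>)" "continuous_on UNIV (partial_t \<phi>)"
    and "\<And>x t. \<not> (\<bar>x\<bar> < R \<and> a < t \<and> t < b) \<Longrightarrow> \<phi> (x, t) = 0 \<and> partial_x \<phi> (x, t) = 0 \<and> partial_t \<phi> (x, t) = 0"
proof -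
  define K where "K = closure {z. \<phi> z \<noteq> 0}"
  have K: "compact K" "K \<subseteq> half_plane" and Ck: "Ck_on (Suc 0) UNIV \<phi>"
    using assms by (auto simp: test_function_def K_def smooth_on_def)
  have D: "(\<phi> has_derivative frechet_derivative \<phi> (at z)) (at z)" for z
    using Ck by (metis Ck_on.simps(2) UNIV_I frechet_derivative_works)
  have cont: "continuous_on UNIV \<phi>"
    using D by (auto intro!: continuous_at_imp_continuous_on has_derivative_continuous)
  have contx: "continuous_on UNIV (partial_x \<phi>)" and contt: "continuous_on UNIV (partial_t \<phi>)"
    using Ck by (auto simp: partial_x_def[abs_def] partial_t_def[abs_def] Basis_prod_def)
  have zero: "\<phi> z = 0 \<and> partial_x \<phi> z = 0 \<and> partial_t \<phi> z = 0" if "z \<notin> K" for z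
  proof -
    have 0: "\<phi> y = 0" if "y \<notin> K" for y
      using that closure_subset[of "{z. \<phi> z \<noteq> 0}"] by (auto simp: K_def)
    have "((\<lambda>_. 0) has_derivative (\<lambda>_. 0)) (at z)" by simp
    then have "(\<phi> has_derivative (\<lambda>_. 0)) (at z)"
      \<comment> \<open>The complement of the closed support is open, so \<open>\<phi>\<close> is
        locally 0 there and its derivatives vanish too.\<close>
      by (rule has_derivative_transform_within_open[where s = "- K"])
         (use K(1) that 0 in \<open>auto intro!: open_Compl compact_imp_closed\<close>)
    from frechet_derivative_at[OF this, symmetric] 0[OF that] show ?thesis
      by (simp add: partial_x_def partial_t_def)
  qed
  obtain M where M: "\<And>z. z \<in> K \<Longrightarrow> norm z \<le> M"
    using compact_imp_bounded[OF K(1)] by (auto simp: bounded_iff)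
  \<comment> \<open>The compact support has positive distance \<open>d\<close> from the closed lower
    half-plane, which bounds its times away from 0.\<close>
  have "closed (UNIV \<times> {..0} :: (real \<times> real) set)" by (intro closed_Times) auto
  moreover have "K \<inter> UNIV \<times> {..0} = {}" using K(2) by force
  ultimately obtain d where d: "0 < d" "\<And>z y. z \<in> K \<Longrightarrow> y \<in> UNIV \<times> {..0} \<Longrightarrow> d \<le> dist z y"
    using separate_compact_closed[OF K(1)] by metis
  have sub: "\<bar>x\<bar> < \<bar>M\<bar> + d + 1 \<and> d / 2 < t \<and> t < \<bar>M\<bar> + d + 1" if "(x, t) \<in> K" for x t
  proof -
    have "d \<le> dist (x, t) (x, 0)" using that by (intro d) auto
    moreover have "0 < t" using that K(2) by auto
    moreover have "\<bar>x\<bar> \<le> M" "\<bar>t\<bar> \<le> M"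
      using M[OF that] norm_fst_le[of x t] norm_snd_le[of t x] by auto
    ultimately show ?thesis using d(1) by (auto simp: dist_Pair_Pair dist_real_def)
  qed
  \<comment> \<open>The summand \<open>d\<close> in the upper bound makes \<open>a < b\<close> hold
    even for an empty support.\<close>
  note supp = that[of "d / 2" "\<bar>M\<bar> + d + 1" "\<bar>M\<bar> + d + 1", OF _ _ _ D cont contx contt]
  have "\<phi> (x, t) = 0 \<and> partial_x \<phi> (x, t) = 0 \<and> partial_t \<phi> (x, t) = 0"
    if "\<not> (\<bar>x\<bar> < \<bar>M\<bar> + d + 1 \<and> d / 2 < t \<and> t < \<bar>M\<bar> + d + 1)" for x t
    using that sub zero by blast
  then show ?thesis
    using d(1) by (intro supp) simp_all
qed

section \<open>The weak form as an integral over the curve\<close>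

definition moving_integral :: "(real \<Rightarrow> real) \<Rightarrow> real \<Rightarrow> real \<Rightarrow> (real \<times> real \<Rightarrow> real) \<Rightarrow> real \<Rightarrow> real" where
  "moving_integral X p q f t = integral {p..q} (\<lambda>y. f (X t + y, t))"

lemma continuous_on_moving_integral:
  assumes X: "continuous_on {0<..} X" and f: "continuous_on UNIV f"
  shows "continuous_on {0<..} (moving_integral X p q f)"
proof -
  have "continuous_on ({0<..} \<times> cbox p q) (\<lambda>(t, y). f (X t + y, t))"
    unfolding case_prod_beta
    by (intro continuous_on_compose2[OF f] continuous_intros continuous_on_compose2[OF X]) auto
  from integral_continuous_on_param[OF this]
  show ?thesis by (simp add: moving_integral_def[abs_def])
qed

text \<open>One quantity with density \<open>l\<close> left of the curve, \<open>r\<close> right of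
  it and mass \<open>m\<close> on it. The functions of \<open>u\<close> are absorbed into
  \<open>l\<close>, \<open>r\<close> and \<open>m\<close>, so mass, momentum and both fluxes are
  instances.\<close>

definition delta_pairing ::
  "(real \<Rightarrow> real) \<Rightarrow> (real \<Rightarrow> real) \<Rightarrow> (real \<Rightarrow> real) \<Rightarrow> (real \<Rightarrow> real) \<Rightarrow> (real \<times> real \<Rightarrow> real) \<Rightarrow> real" where
  "delta_pairing X l r m \<phi> =
     (LINT t:{0<..}|lborel. LINT x|lborel. (if x < X t then l t else r t) * \<phi> (x, t))
     + (LINT t:{0<..}|lborel. m t * \<phi> (X t, t))"

lemma delta_pairing_moving_frame:
  assumes cont: "continuous_on {0<..} X" "continuous_on {0<..} l" "continuous_on {0<..} r" "continuous_on {0<..} m"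
    and f: "continuous_on UNIV f" "\<And>x t. \<not> (\<bar>x\<bar> < R0 \<and> a < t \<and> t < b) \<Longrightarrow> f (x, t) = 0"
    and R: "0 < a" "0 < R0" "\<And>t. t \<in> {a..b} \<Longrightarrow> \<bar>X t\<bar> + R0 \<le> R" "0 \<le> R"
  shows "((\<lambda>t. l t * moving_integral X (-R) 0 f t + r t * moving_integral X 0 R f t + m t * f (X t, t))
    has_integral delta_pairing X l r m f) {a..b}"
proof -
  note contI = continuous_on_moving_integral[OF cont(1) f(1)]
  have contL: "continuous_on {0<..} (\<lambda>t. l t * moving_integral X (-R) 0 f t + r t * moving_integral X 0 R f t)"
    by (intro continuous_intros contI cont)
  have contm: "continuous_on {0<..} (\<lambda>t. m t * f (X t, t))"
    by (intro continuous_intros cont continuous_on_compose2[OF f(1)]) auto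
  have inner: "(LINT x|lborel. (if x < X t then l t else r t) * f (x, t))
      = l t * moving_integral X (-R) 0 f t + r t * moving_integral X 0 R f t" for t
  proof -
    have "(LINT x|lborel. (if x < X t then l t else r t) * f (x, t))
        = (LINT y|lborel. (if y < 0 then l t else r t) * f (X t + y, t))"
      by (subst LINT_translate[where c = "X t"]) simp
    also have "\<dots> = l t * integral {-R..0} (\<lambda>y. f (X t + y, t)) + r t * integral {0..R} (\<lambda>y. f (X t + y, t))"
    proof (rule LINT_step_centred)
      show "continuous_on UNIV (\<lambda>y. f (X t + y, t))"
        by (intro continuous_on_compose2[OF f(1)] continuous_intros) auto
      \<comment> \<open>For \<open>t\<close> in \<open>{a..b}\<close> the choice of \<open>R\<close>
        gives \<open>\<bar>X t + y\<bar> > R0\<close>; for all other times \<open>f\<close> vanishes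
        already.\<close>
      show "f (X t + y, t) = 0" if "R < \<bar>y\<bar>" for y
        using R(3)[of t] that by (intro f(2)) auto
    qed (fact R)
    finally show ?thesis by (simp add: moving_integral_def)
  qed
  have zero: "moving_integral X p q f t = 0" if "\<not> (a < t \<and> t < b)" for p q t
    using f(2)[of _ t] that by (simp add: moving_integral_def)
  have "(LINT t:{0<..}|lborel. LINT x|lborel. (if x < X t then l t else r t) * f (x, t))
      = integral {a..b} (\<lambda>t. l t * moving_integral X (-R) 0 f t + r t * moving_integral X 0 R f t)"
    unfolding inner using R(1) zero by (intro LINT_positive_axis contL) auto
  moreover have "(LINT t:{0<..}|lborel. m t * f (X t, t)) = integral {a..b} (\<lambda>t. m t * f (X t, t))"
    using R(1) f(2) by (intro LINT_positive_axis contm) auto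
  moreover have "{a..b} \<subseteq> {0<..}" using R(1) by auto
  then have "(\<lambda>t. l t * moving_integral X (-R) 0 f t + r t * moving_integral X 0 R f t) integrable_on {a..b}"
    "(\<lambda>t. m t * f (X t, t)) integrable_on {a..b}"
    by (intro integrable_continuous_interval continuous_on_subset[OF contL] continuous_on_subset[OF contm]; simp)+
  ultimately show ?thesis
    unfolding delta_pairing_def by (simp add: has_integral_add integrable_integral)
qed

lemma moving_frame_derivative:
  assumes \<phi>: "(\<phi> has_derivative frechet_derivative \<phi> (at (X t + y, t))) (at (X t + y, t))"
    and X: "(X has_real_derivative X') (at t)"
  shows "((\<lambda>s. \<phi> (X s + y, s)) has_real_derivative
    partial_t \<phi> (X t + y, t) + X' * partial_x \<phi> (X t + y, t)) (at t)"
proof -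
  have g: "((\<lambda>s. (X s + y, s)) has_derivative (\<lambda>h. (X' * h, h))) (at t)"
    using X by (auto intro!: derivative_eq_intros simp: has_field_derivative_def)
  interpret linear "frechet_derivative \<phi> (at (X t + y, t))"
    using \<phi> has_derivative_linear by blast
  have "frechet_derivative \<phi> (at (X t + y, t)) (X' * h, h)
      = (partial_t \<phi> (X t + y, t) + X' * partial_x \<phi> (X t + y, t)) * h" for h
  proof -
    have "(X' * h, h) = (X' * h) *\<^sub>R (1, 0) + h *\<^sub>R (0, 1)" by simp
    then have "frechet_derivative \<phi> (at (X t + y, t)) (X' * h, h)
        = (X' * h) * partial_x \<phi> (X t + y, t) + h * partial_t \<phi> (X t + y, t)"
      by (simp only: add scale partial_x_def partial_t_def real_scaleR_def)
    then show ?thesis by (simp add: algebra_simps)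
  qed
  with has_derivative_compose[OF g \<phi>] show ?thesis
    by (simp add: has_field_derivative_def)
qed

lemma moving_integral_derivative:
  assumes \<phi>: "\<And>z. (\<phi> has_derivative frechet_derivative \<phi> (at z)) (at z)"
    and cont: "continuous_on UNIV \<phi>" "continuous_on UNIV (partial_x \<phi>)" "continuous_on UNIV (partial_t \<phi>)"
    and X: "\<And>t. 0 < t \<Longrightarrow> (X has_real_derivative X' t) (at t)" "continuous_on {0<..} X'"
    and t: "0 < t"
  shows "(moving_integral X p q \<phi> has_real_derivative
    moving_integral X p q (partial_t \<phi>) t + X' t * moving_integral X p q (partial_x \<phi>) t) (at t)"
proof -
  have contX: "continuous_on {0<..} X"
    using X(1) by (auto intro!: continuous_at_imp_continuous_on DERIV_isCont)
  have shift: "continuous_on {p..q} (\<lambda>y. f (X t + y, t))" if "continuous_on UNIV f" for f :: "real \<times> real \<Rightarrow> real" and t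
    by (intro continuous_on_compose2[OF that] continuous_intros) auto
  have "((\<lambda>s. integral (cbox p q) (\<lambda>y. \<phi> (X s + y, s))) has_vector_derivative
      integral (cbox p q) (\<lambda>y. partial_t \<phi> (X t + y, t) + X' t * partial_x \<phi> (X t + y, t))) (at t within {0<..})"
  proof (rule leibniz_rule_vector_derivative)
    show "((\<lambda>s. \<phi> (X s + y, s)) has_vector_derivative
        partial_t \<phi> (X s + y, s) + X' s * partial_x \<phi> (X s + y, s)) (at s within {0<..})" if "s \<in> {0<..}" for s y
      using moving_frame_derivative[of \<phi> X s y "X' s"] \<phi> X(1) that
      by (simp add: has_real_derivative_iff_has_vector_derivative has_vector_derivative_at_within)
    show "(\<lambda>y. \<phi> (X s + y, s)) integrable_on cbox p q" for s
      using shift[OF cont(1)] by (simp add: integrable_continuous_interval)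
    show "continuous_on ({0<..} \<times> cbox p q) (\<lambda>(s, y). partial_t \<phi> (X s + y, s) + X' s * partial_x \<phi> (X s + y, s))"
      unfolding case_prod_beta
      by (intro continuous_intros continuous_on_compose2[OF cont(2)] continuous_on_compose2[OF cont(3)]
          continuous_on_compose2[OF contX] continuous_on_compose2[OF X(2)]) auto
  qed (use t in auto)
  moreover have "integral (cbox p q) (\<lambda>y. partial_t \<phi> (X t + y, t) + X' t * partial_x \<phi> (X t + y, t))
      = moving_integral X p q (partial_t \<phi>) t + X' t * moving_integral X p q (partial_x \<phi>) t"
    unfolding moving_integral_def interval_cbox[symmetric]
    by (intro integral_unique has_integral_add has_integral_mult_right integrable_integral
        integrable_continuous_interval shift cont)
  ultimately show ?thesis
    using t by (simp add: moving_integral_def[abs_def] has_real_derivative_iff_has_vector_derivative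
        at_within_open[of t "{0<..}"])
qed

text \<open>The endpoint \<open>y = 0\<close> yields the trace of \<open>\<phi>\<close> on the
  curve, from which the jump terms arise; the other endpoint will be chosen outside the
  support.\<close>

lemma moving_integral_partial_x:
  assumes \<phi>: "\<And>z. (\<phi> has_derivative frechet_derivative \<phi> (at z)) (at z)" and "p \<le> q"
  shows "moving_integral X p q (partial_x \<phi>) t = \<phi> (X t + q, t) - \<phi> (X t + p, t)"
proof -
  have "((\<lambda>y. \<phi> (X t + y, t)) has_vector_derivative partial_x \<phi> (X t + y, t)) (at y within {p..q})" for y
  proof -
    have g: "((\<lambda>y. (X t + y, t)) has_derivative (\<lambda>h. (h, 0))) (at y)"
      by (auto intro!: derivative_eq_intros)
    interpret linear "frechet_derivative \<phi> (at (X t + y, t))"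
      using \<phi> has_derivative_linear by blast
    have "frechet_derivative \<phi> (at (X t + y, t)) (h, 0) = h * partial_x \<phi> (X t + y, t)" for h
      using scale[of h "(1, 0)"] by (simp add: partial_x_def)
    with has_derivative_compose[OF g \<phi>] show ?thesis
      by (simp add: has_vector_derivative_def has_derivative_at_withinI)
  qed
  then have "((\<lambda>y. partial_x \<phi> (X t + y, t)) has_integral \<phi> (X t + q, t) - \<phi> (X t + p, t)) {p..q}"
    by (intro fundamental_theorem_of_calculus assms(2))
  then show ?thesis by (simp add: moving_integral_def integral_unique)
qed

text \<open>The identity is the integral over \<open>t\<close> of the derivative of the total pairing at time \<open>t\<close>,
  which vanishes for a test function.\<close>
lemma delta_pairing_balance:
  assumes X: "\<And>t. 0 < t \<Longrightarrow> (X has_real_derivative X' t) (at t)" "continuous_on {0<..} X'"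
    and l: "\<And>t. 0 < t \<Longrightarrow> (l has_real_derivative - \<beta> * l t) (at t)"
    and r: "\<And>t. 0 < t \<Longrightarrow> (r has_real_derivative - \<beta> * r t) (at t)"
    and m: "\<And>t. 0 < t \<Longrightarrow> (m has_real_derivative m' t) (at t)" "continuous_on {0<..} m'"
    and flux: "continuous_on {0<..} l2" "continuous_on {0<..} r2" "continuous_on {0<..} m2"
    and \<phi>: "test_function half_plane \<phi>"
  shows "delta_pairing X l r m (partial_t \<phi>) + delta_pairing X l2 r2 m2 (partial_x \<phi>) - \<beta> * delta_pairing X l r m \<phi>
    = (LINT t:{0<..}|lborel. (l2 t - r2 t - (l t - r t) * X' t - m' t - \<beta> * m t) * \<phi> (X t, t)
        + (m2 t - m t * X' t) * partial_x \<phi> (X t, t))"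
proof -
  obtain a b R0 where ab: "0 < a" "a < b" "0 < R0"
    and D: "\<And>z. (\<phi> has_derivative frechet_derivative \<phi> (at z)) (at z)"
    and cont\<phi>: "continuous_on UNIV \<phi>" "continuous_on UNIV (partial_x \<phi>)" "continuous_on UNIV (partial_t \<phi>)"
    and supp: "\<And>x t. \<not> (\<bar>x\<bar> < R0 \<and> a < t \<and> t < b) \<Longrightarrow> \<phi> (x, t) = 0 \<and> partial_x \<phi> (x, t) = 0 \<and> partial_t \<phi> (x, t) = 0"
    using test_functionD[OF \<phi>] by metis
  have cont: "continuous_on {0<..} X" "continuous_on {0<..} l" "continuous_on {0<..} r" "continuous_on {0<..} m"
    using X(1) l r m(1) by (auto intro!: continuous_at_imp_continuous_on DERIV_isCont)
  have "bounded (X ` {a..b})"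
    using ab by (intro compact_imp_bounded compact_continuous_image continuous_on_subset[OF cont(1)]) auto
  then obtain M where M: "\<forall>t\<in>{a..b}. \<bar>X t\<bar> \<le> M"
    by (auto simp: bounded_iff)
  \<comment> \<open>Wide enough that, during \<open>{a..b}\<close>, the support seen from the moving
    curve lies within \<open>{-R..R}\<close>.\<close>
  define R where "R = \<bar>M\<bar> + R0"
  have R: "0 \<le> R"
    using ab by (simp add: R_def)
  have RX: "\<bar>X t\<bar> + R0 \<le> R" if "t \<in> {a..b}" for t
    using ab bspec[OF M that] by (auto simp: R_def)
  let ?L = "moving_integral X (-R) 0" and ?R = "moving_integral X 0 R"
  define A where "A t = l2 t - r2 t - (l t - r t) * X' t - m' t - \<beta> * m t" for t
  define B where "B t = m2 t - m t * X' t" for t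
  have on_curve: "continuous_on {0<..} (\<lambda>t. f (X t, t))" if "continuous_on UNIV f" for f :: "real \<times> real \<Rightarrow> real"
    by (intro continuous_on_compose2[OF that] continuous_intros cont) auto
  have contAB: "continuous_on {0<..} (\<lambda>t. A t * \<phi> (X t, t) + B t * partial_x \<phi> (X t, t))"
    unfolding A_def B_def by (intro continuous_intros on_curve cont\<phi> cont flux X m)
  define E where "E t = l t * ?L \<phi> t + r t * ?R \<phi> t + m t * \<phi> (X t, t)" for t
  define P1 where "P1 t = l t * ?L (partial_t \<phi>) t + r t * ?R (partial_t \<phi>) t + m t * partial_t \<phi> (X t, t)" for t
  define P2 where "P2 t = l2 t * ?L (partial_x \<phi>) t + r2 t * ?R (partial_x \<phi>) t + m2 t * partial_x \<phi> (X t, t)" for t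
  have int: "(P1 has_integral delta_pairing X l r m (partial_t \<phi>)) {a..b}"
    "(P2 has_integral delta_pairing X l2 r2 m2 (partial_x \<phi>)) {a..b}"
    "(E has_integral delta_pairing X l r m \<phi>) {a..b}"
    unfolding P1_def[abs_def] P2_def[abs_def] E_def[abs_def]
    by (rule delta_pairing_moving_frame[OF _ _ _ _ _ _ ab(1,3) RX R]; use cont flux cont\<phi> supp in blast)+
  \<comment> \<open>The traces from the two sides have opposite signs, which turns \<open>l2\<close>
    and \<open>r2\<close> into the difference \<open>l2 - r2\<close>.\<close>
  have edge: "?L (partial_x \<phi>) t = \<phi> (X t, t)" "?R (partial_x \<phi>) t = - \<phi> (X t, t)" if "t \<in> {a..b}" for t
  proof -
    have "\<not> \<bar>X t + - R\<bar> < R0" "\<not> \<bar>X t + R\<bar> < R0"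
      using RX[OF that] by auto
    then have "\<phi> (X t + - R, t) = 0" "\<phi> (X t + R, t) = 0"
      using supp by blast+
    then show "?L (partial_x \<phi>) t = \<phi> (X t, t)" "?R (partial_x \<phi>) t = - \<phi> (X t, t)"
      using R by (simp_all add: moving_integral_partial_x[OF D])
  qed
  \<comment> \<open>Chosen as the difference of the two integrands in the claim; the algebra below
    identifies it with the derivative of \<open>E\<close>, whose integral is 0 since
    \<open>E\<close> vanishes at both ends.\<close>
  define E' where "E' t = P1 t + P2 t - \<beta> * E t - (A t * \<phi> (X t, t) + B t * partial_x \<phi> (X t, t))" for t
  have dE: "(E has_real_derivative E' t) (at t)" if t: "t \<in> {a..b}" for t
  proof -
    have t0: "0 < t" using t ab by auto
    note dI = moving_integral_derivative[OF D cont\<phi> X t0]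
    have d\<phi>: "((\<lambda>s. \<phi> (X s, s)) has_real_derivative partial_t \<phi> (X t, t) + X' t * partial_x \<phi> (X t, t)) (at t)"
      using moving_frame_derivative[OF D X(1)[OF t0], of 0] by simp
    note dE = DERIV_add[OF DERIV_add[OF DERIV_mult[OF l[OF t0] dI[of "-R" 0]] DERIV_mult[OF r[OF t0] dI[of 0 R]]]
        DERIV_mult[OF m(1)[OF t0] d\<phi>]]
    show ?thesis
      unfolding E_def
    proof (rule DERIV_cong[OF dE])
      show "- \<beta> * l t * ?L \<phi> t + (?L (partial_t \<phi>) t + X' t * ?L (partial_x \<phi>) t) * l t
          + (- \<beta> * r t * ?R \<phi> t + (?R (partial_t \<phi>) t + X' t * ?R (partial_x \<phi>) t) * r t)
          + (m' t * \<phi> (X t, t) + (partial_t \<phi> (X t, t) + X' t * partial_x \<phi> (X t, t)) * m t) = E' t"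
        unfolding E'_def P1_def P2_def A_def B_def E_def edge[OF t] by algebra
    qed
  qed
  have "(E' has_integral E b - E a) {a..b}"
    using ab dE
    by (intro fundamental_theorem_of_calculus)
       (auto simp: has_real_derivative_iff_has_vector_derivative has_vector_derivative_at_within)
  moreover have "E a = 0" "E b = 0"
    using supp by (simp_all add: E_def moving_integral_def)
  moreover have "((\<lambda>t. P1 t + P2 t - \<beta> * E t - E' t) has_integral
      delta_pairing X l r m (partial_t \<phi>) + delta_pairing X l2 r2 m2 (partial_x \<phi>) - \<beta> * delta_pairing X l r m \<phi> - (E b - E a)) {a..b}"
    by (intro has_integral_diff has_integral_add has_integral_mult_right int \<open>(E' has_integral E b - E a) {a..b}\<close>)
  ultimately have "((\<lambda>t. A t * \<phi> (X t, t) + B t * partial_x \<phi> (X t, t)) has_integral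
      delta_pairing X l r m (partial_t \<phi>) + delta_pairing X l2 r2 m2 (partial_x \<phi>) - \<beta> * delta_pairing X l r m \<phi>) {a..b}"
    by (simp add: E'_def)
  moreover have "(LINT t:{0<..}|lborel. A t * \<phi> (X t, t) + B t * partial_x \<phi> (X t, t))
      = integral {a..b} (\<lambda>t. A t * \<phi> (X t, t) + B t * partial_x \<phi> (X t, t))"
    using ab supp by (intro LINT_positive_axis contAB) auto
  ultimately show ?thesis
    by (simp add: integral_unique A_def B_def)
qed

text \<open>The time factor localizes at \<open>t\<close>, leaving one linear relation between
  \<open>A t\<close> and \<open>B t\<close> for each bump in \<open>x\<close>. Two positions of its
  centre give independent relations.\<close>

lemma curve_test_imp_zero:
  assumes X: "continuous_on {0<..} X" and cont: "continuous_on {0<..} A" "continuous_on {0<..} B"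
    and test: "\<And>\<phi>. test_function half_plane \<phi> \<Longrightarrow>
      (LINT t:{0<..}|lborel. A t * \<phi> (X t, t) + B t * partial_x \<phi> (X t, t)) = 0"
    and t: "0 < t"
  shows "A t = 0" and "B t = 0"
proof -
  have key: "A t * bump c 1 (X t) + B t * b' = 0"
    if b': "(bump c 1 has_real_derivative b') (at (X t))" for c b'
  proof -
    obtain f where f: "f \<in> bump_space" "\<And>x. (bump c 1 has_real_derivative f x) (at x)"
      using bump_space_deriv[OF bump_in_bump_space, of c 1] by blast
    obtain f' where f': "\<And>x. (f has_real_derivative f' x) (at x)"
      using bump_space_deriv[OF f(1)] by blast
    have contf: "continuous_on UNIV f"
      using f' by (auto intro!: continuous_at_imp_continuous_on DERIV_isCont)
    have contX: "continuous_on {0<..} (\<lambda>s. bump c 1 (X s))" "continuous_on {0<..} (\<lambda>s. f (X s))"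
      using X continuous_bump contf
      by (auto intro: continuous_on_compose2[of UNIV _ "{0<..}" X])
    have "A t * bump c 1 (X t) + B t * f (X t) = 0"
    proof (rule bump_test_imp_zero[OF _ _ t])
      show "continuous_on {0<..} (\<lambda>s. A s * bump c 1 (X s) + B s * f (X s))"
        by (intro continuous_intros cont contX)
      fix t e :: real assume e: "0 < e" "e < t"
      let ?\<phi> = "\<lambda>z. bump c 1 (fst z) * bump t e (snd z)"
      have "partial_x ?\<phi> z = f (fst z) * bump t e (snd z)" for z
      proof -
        obtain g where g: "\<And>x. (bump t e has_real_derivative g x) (at x)"
          using bump_space_deriv[OF bump_in_bump_space, of t e] by blast
        have "(?\<phi> has_derivative (\<lambda>h. bump c 1 (fst z) * (g (snd z) * snd h) + f (fst z) * fst h * bump t e (snd z))) (at z)"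
          by (rule has_derivative_mult
              has_derivative_compose[OF has_derivative_fst[OF has_derivative_ident] f(2)[unfolded has_field_derivative_def]]
              has_derivative_compose[OF has_derivative_snd[OF has_derivative_ident] g[unfolded has_field_derivative_def]])+
        from frechet_derivative_at[OF this, symmetric] show ?thesis
          by (simp add: partial_x_def)
      qed
      then show "(LINT s:{0<..}|lborel. (A s * bump c 1 (X s) + B s * f (X s)) * bump t e s) = 0"
        using test[OF test_function_bump_tensor[of 1 e t c]] e by (simp add: algebra_simps)
    qed
    moreover have "f (X t) = b'" using DERIV_unique[OF f(2) b'] .
    ultimately show ?thesis by simp
  qed
  have pos: "0 < bump c 1 (X t)" if "\<bar>X t - c\<bar> < 1" for c
    using bump_pos_iff[of 1 c "X t"] that by simp
  \<comment> \<open>Centred on the curve, the bump has positive value and slope 0.\<close>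
  show A: "A t = 0"
    using key[OF bump_has_deriv[of "X t" "X t" 1]] pos[of "X t"] by simp
  \<comment> \<open>Half a radius off centre the slope is nonzero, and \<open>A t\<close> is already
    gone.\<close>
  show "B t = 0"
    using key[OF bump_has_deriv[of "X t" "X t - 1/2" 1]] pos[of "X t - 1/2"] A by (simp add: power2_eq_square)
qed

text \<open>The decay rate of \<open>l\<close> and \<open>r\<close> equals the damping coefficient
  \<open>\<beta>\<close>, so nothing is left off the curve and the weak form is a condition on the
  curve only.\<close>

lemma delta_pairing_balance_iff:
  assumes X: "\<And>t. 0 < t \<Longrightarrow> (X has_real_derivative X' t) (at t)" "continuous_on {0<..} X'"
    and l: "\<And>t. 0 < t \<Longrightarrow> (l has_real_derivative - \<beta> * l t) (at t)"
    and r: "\<And>t. 0 < t \<Longrightarrow> (r has_real_derivative - \<beta> * r t) (at t)"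
    and m: "\<And>t. 0 < t \<Longrightarrow> (m has_real_derivative m' t) (at t)" "continuous_on {0<..} m'"
    and flux: "continuous_on {0<..} l2" "continuous_on {0<..} r2" "continuous_on {0<..} m2"
  shows "(\<forall>\<phi>. test_function half_plane \<phi> \<longrightarrow>
      delta_pairing X l r m (partial_t \<phi>) + delta_pairing X l2 r2 m2 (partial_x \<phi>) = \<beta> * delta_pairing X l r m \<phi>)
    \<longleftrightarrow> (\<forall>t>0. l2 t - r2 t - (l t - r t) * X' t - m' t - \<beta> * m t = 0 \<and> m2 t = m t * X' t)"
    (is "?weak \<longleftrightarrow> ?jump")
proof
  define A where "A t = l2 t - r2 t - (l t - r t) * X' t - m' t - \<beta> * m t" for t
  define B where "B t = m2 t - m t * X' t" for t
  have balance: "delta_pairing X l r m (partial_t \<phi>) + delta_pairing X l2 r2 m2 (partial_x \<phi>) - \<beta> * delta_pairing X l r m \<phi>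
      = (LINT t:{0<..}|lborel. A t * \<phi> (X t, t) + B t * partial_x \<phi> (X t, t))"
    if "test_function half_plane \<phi>" for \<phi>
    unfolding A_def B_def by (rule delta_pairing_balance) (use assms that in auto)
  have cont: "continuous_on {0<..} X" "continuous_on {0<..} l" "continuous_on {0<..} r" "continuous_on {0<..} m"
    using X(1) l r m(1) by (auto intro!: continuous_at_imp_continuous_on DERIV_isCont)
  have contAB: "continuous_on {0<..} A" "continuous_on {0<..} B"
    unfolding A_def B_def by (intro continuous_intros cont flux X m)+
  show ?jump if ?weak
  proof -
    have "(LINT t:{0<..}|lborel. A t * \<phi> (X t, t) + B t * partial_x \<phi> (X t, t)) = 0"
      if "test_function half_plane \<phi>" for \<phi>
      using balance[OF that] \<open>?weak\<close> that by simp
    from curve_test_imp_zero[OF cont(1) contAB this] show ?thesis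
      by (simp add: A_def B_def)
  qed
  show ?weak if ?jump
  proof (intro allI impI)
    fix \<phi> :: "real \<times> real \<Rightarrow> real" assume \<phi>: "test_function half_plane \<phi>"
    have "(LINT t:{0<..}|lborel. A t * \<phi> (X t, t) + B t * partial_x \<phi> (X t, t)) = (LINT t:{0::real<..}|lborel. 0)"
      by (rule set_lebesgue_integral_cong) (use \<open>?jump\<close> in \<open>auto simp: A_def B_def\<close>)
    then show "delta_pairing X l r m (partial_t \<phi>) + delta_pairing X l2 r2 m2 (partial_x \<phi>) = \<beta> * delta_pairing X l r m \<phi>"
      using balance[OF \<phi>] by simp
  qed
qed

lemma pairing_two_states:
  "pairing X w uL (two_states X vl vr) (two_states X ul ur) G \<phi> =
    delta_pairing X (\<lambda>t. vl t * G (ul t)) (\<lambda>t. vr t * G (ur t)) (\<lambda>t. w t * G (uL t)) \<phi>"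
proof -
  have "two_states X vl vr (x, t) * G (two_states X ul ur (x, t)) * \<phi> (x, t)
      = (if x < X t then vl t * G (ul t) else vr t * G (ur t)) * \<phi> (x, t)" for x t
    by (simp add: two_states_def)
  then show ?thesis
    by (simp only: pairing_def delta_pairing_def weighted_delta_def)
qed

text \<open>The second equation says that the derivative of the delta function does not occur in the
  mass balance; multiplied by \<open>ud * E\<close> it says so for the momentum balance.\<close>
definition jump_conditions ::
  "nat \<Rightarrow> real \<Rightarrow> real \<Rightarrow> real \<Rightarrow> real \<Rightarrow> real \<Rightarrow> (real \<Rightarrow> real) \<Rightarrow> (real \<Rightarrow> real) \<Rightarrow> (real \<Rightarrow> real) \<Rightarrow> real \<Rightarrow> real \<Rightarrow> bool"
  where "jump_conditions k \<alpha> vm vp um up X' w w' ud t \<longleftrightarrow>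
    (let E = exp (- \<alpha> * t) in
      w' t = vm * (um * E) ^ k - vp * (up * E) ^ k - (vm - vp) * X' t \<and>
      w t * (ud * E) ^ k = w t * X' t \<and>
      w' t * (ud * E) = vm * (um * E) ^ (k + 1) - vp * (up * E) ^ (k + 1) - (vm * (um * E) - vp * (up * E)) * X' t)"

lemma weak_form_iff_jump_conditions:
  fixes vm vp um up ud \<alpha> :: real
  defines "vt \<equiv> \<lambda>X. two_states X (\<lambda>_. vm) (\<lambda>_. vp)"
    and "ut \<equiv> \<lambda>X. two_states X (\<lambda>t. um * exp (- \<alpha> * t)) (\<lambda>t. up * exp (- \<alpha> * t))"
    and "uL \<equiv> \<lambda>t. ud * exp (- \<alpha> * t)"
  assumes X: "\<And>t. 0 < t \<Longrightarrow> (X has_real_derivative X' t) (at t)" "continuous_on {0<..} X'"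
    and w: "\<And>t. 0 < t \<Longrightarrow> (w has_real_derivative w' t) (at t)" "continuous_on {0<..} w'"
  shows "(\<forall>\<phi>. test_function half_plane \<phi> \<longrightarrow>
        pairing X w uL (vt X) (ut X) (\<lambda>_. 1) (partial_t \<phi>)
          + pairing X w uL (vt X) (ut X) (\<lambda>u. u ^ k) (partial_x \<phi>) = 0 \<and>
        pairing X w uL (vt X) (ut X) (\<lambda>u. u) (partial_t \<phi>)
          + pairing X w uL (vt X) (ut X) (\<lambda>u. u ^ (k + 1)) (partial_x \<phi>)
          = \<alpha> * pairing X w uL (vt X) (ut X) (\<lambda>u. u) \<phi>)
    \<longleftrightarrow> (\<forall>t>0. jump_conditions k \<alpha> vm vp um up X' w w' ud t)"
proof -
  let ?E = "\<lambda>t. exp (- \<alpha> * t)"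
  have contw: "continuous_on {0<..} w"
    using w(1) by (auto intro!: continuous_at_imp_continuous_on DERIV_isCont)
  have dE: "((\<lambda>t. v * (u * ?E t)) has_real_derivative - \<alpha> * (v * (u * ?E t))) (at t)" for u v t
    by (auto intro!: derivative_eq_intros)
  \<comment> \<open>The decay of \<open>ud * ?E t\<close> contributes exactly the damping of the
    momentum carried by the curve, so the two cancel in the jump condition.\<close>
  have dm: "((\<lambda>t. w t * (ud * ?E t)) has_real_derivative w' t * (ud * ?E t) - \<alpha> * (w t * (ud * ?E t))) (at t)"
    if "0 < t" for t
    by (rule derivative_eq_intros refl w(1) that)+ (simp add: algebra_simps)
  note cont = continuous_intros contw w(2) X(2)
  \<comment> \<open>The factors 0 and 1 are kept to match the general equivalence with
    \<open>\<beta> = 0\<close> and constant \<open>G\<close>.\<close>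
  have "(\<forall>\<phi>. test_function half_plane \<phi> \<longrightarrow>
        pairing X w uL (vt X) (ut X) (\<lambda>_. 1) (partial_t \<phi>)
          + pairing X w uL (vt X) (ut X) (\<lambda>u. u ^ k) (partial_x \<phi>) = 0 * pairing X w uL (vt X) (ut X) (\<lambda>_. 1) \<phi>)
     \<longleftrightarrow> (\<forall>t>0. vm * (um * ?E t) ^ k - vp * (up * ?E t) ^ k - (vm * 1 - vp * 1) * X' t - w' t - 0 * (w t * 1) = 0
           \<and> w t * (ud * ?E t) ^ k = w t * 1 * X' t)"
    unfolding vt_def ut_def uL_def pairing_two_states
    by (rule delta_pairing_balance_iff) (auto intro!: cont w X)
  moreover have "(\<forall>\<phi>. test_function half_plane \<phi> \<longrightarrow>
        pairing X w uL (vt X) (ut X) (\<lambda>u. u) (partial_t \<phi>)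
          + pairing X w uL (vt X) (ut X) (\<lambda>u. u ^ (k + 1)) (partial_x \<phi>) = \<alpha> * pairing X w uL (vt X) (ut X) (\<lambda>u. u) \<phi>)
     \<longleftrightarrow> (\<forall>t>0. vm * (um * ?E t) ^ (k + 1) - vp * (up * ?E t) ^ (k + 1) - (vm * (um * ?E t) - vp * (up * ?E t)) * X' t
             - (w' t * (ud * ?E t) - \<alpha> * (w t * (ud * ?E t))) - \<alpha> * (w t * (ud * ?E t)) = 0
           \<and> w t * (ud * ?E t) ^ (k + 1) = w t * (ud * ?E t) * X' t)"
    unfolding vt_def ut_def uL_def pairing_two_states
    by (rule delta_pairing_balance_iff) (intro cont X dE dm | assumption)+
  moreover have "w t * (ud * ?E t) ^ k = w t * X' t \<Longrightarrow> w t * (ud * ?E t) ^ (k + 1) = w t * (ud * ?E t) * X' t" for t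
    by (simp add: mult_ac)
  ultimately show ?thesis
    unfolding jump_conditions_def Let_def by (fastforce simp: algebra_simps)
qed

section \<open>Attainment of the initial data\<close>

lemma test_function_realD:
  assumes "test_function UNIV (\<psi> :: real \<Rightarrow> real)"
  obtains R where "0 < R" "continuous_on UNIV \<psi>" "\<forall>x. R < \<bar>x\<bar> \<longrightarrow> \<psi> x = 0"
proof -
  have "Ck_on 0 UNIV \<psi>" and "compact (closure {x. \<psi> x \<noteq> 0})"
    using assms unfolding test_function_def smooth_on_def by blast+
  then obtain M where M: "\<forall>x\<in>{x. \<psi> x \<noteq> 0}. \<bar>x\<bar> \<le> M"
    by (auto simp: compact_closure bounded_iff)
  have "\<psi> x = 0" if "\<bar>M\<bar> + 1 < \<bar>x\<bar>" for x
    using M that by (cases "\<psi> x = 0") auto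
  then show ?thesis
    using that[of "\<bar>M\<bar> + 1"] \<open>Ck_on 0 UNIV \<psi>\<close> by simp
qed

lemma LINT_two_states:
  fixes \<psi> :: "real \<Rightarrow> real"
  assumes "continuous_on UNIV \<psi>" "\<forall>x. R < \<bar>x\<bar> \<longrightarrow> \<psi> x = 0"
  shows "(LINT x|lborel. two_states X l r (x, t) * \<psi> x)
      = r t * (LINT x|lborel. \<psi> x) + (l t - r t) * (LINT x:{..<X t}|lborel. \<psi> x)"
    and "(LINT x|lborel. riemann_data c d x * \<psi> x)
      = d * (LINT x|lborel. \<psi> x) + (c - d) * (LINT x:{..<0}|lborel. \<psi> x)"
  unfolding two_states_def riemann_data_def prod.case
  by (rule LINT_step[of _ R]; use assms in blast)+

lemma isCont_LINT_lessThan: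
  fixes f :: "real \<Rightarrow> real"
  assumes "continuous_on UNIV f" "\<forall>x. R < \<bar>x\<bar> \<longrightarrow> f x = 0" "0 < R"
  shows "isCont (\<lambda>c. LINT x:{..<c}|lborel. f x) 0"
proof -
  have "(\<lambda>c. LINT x:{..<c}|lborel. f x) = (\<lambda>c. integral {-R..c} f)"
    using LINT_lessThan assms(1,2) by blast
  moreover have "f integrable_on {-R..R}"
    by (intro integrable_continuous_interval continuous_on_subset[OF assms(1)]) auto
  from indefinite_integral_continuous_1[OF this]
  have "isCont (\<lambda>c. integral {-R..c} f) 0"
    by (rule continuous_on_interior) (use assms(3) in auto)
  ultimately show ?thesis by simp
qed

lemma exp_at_right_0: "((\<lambda>t. c * exp (- \<alpha> * t)) \<longlongrightarrow> c) (at_right (0::real))"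
proof -
  have "((\<lambda>t. c * exp (- \<alpha> * t)) \<longlongrightarrow> c * exp (- \<alpha> * 0)) (at_right 0)"
    by (intro tendsto_intros)
  then show ?thesis by simp
qed

lemma attains_initial_dataI:
  fixes vm vp um up \<alpha> :: real
  assumes X: "(X \<longlongrightarrow> 0) (at_right 0)" and w: "(w \<longlongrightarrow> 0) (at_right 0)"
  shows "attains_initial_data X w (two_states X (\<lambda>_. vm) (\<lambda>_. vp))
    (two_states X (\<lambda>t. um * exp (- \<alpha> * t)) (\<lambda>t. up * exp (- \<alpha> * t))) (riemann_data vm vp) (riemann_data um up)"
  unfolding attains_initial_data_def
proof (intro allI impI)
  fix \<psi> :: "real \<Rightarrow> real" assume "test_function UNIV \<psi>"
  then obtain R where R: "0 < R" "continuous_on UNIV \<psi>" "\<forall>x. R < \<bar>x\<bar> \<longrightarrow> \<psi> x = 0"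
    by (rule test_function_realD) blast
  let ?K = "\<lambda>c. LINT x:{..<c}|lborel. \<psi> x"
  have K: "((\<lambda>t. ?K (X t)) \<longlongrightarrow> ?K 0) (at_right 0)"
    using isCont_tendsto_compose[OF isCont_LINT_lessThan[OF R(2,3,1)] X] by blast
  have "isCont \<psi> 0"
    using R(2) by (simp add: continuous_on_eq_continuous_at)
  note \<psi> = isCont_tendsto_compose[OF this X]
  have "((\<lambda>t. vp * (LINT x|lborel. \<psi> x) + (vm - vp) * ?K (X t) + w t * \<psi> (X t))
      \<longlongrightarrow> vp * (LINT x|lborel. \<psi> x) + (vm - vp) * ?K 0 + 0 * \<psi> 0) (at_right 0)"
    by (intro tendsto_intros K \<psi> w)
  moreover have "((\<lambda>t. up * exp (- \<alpha> * t) * (LINT x|lborel. \<psi> x) + (um * exp (- \<alpha> * t) - up * exp (- \<alpha> * t)) * ?K (X t))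
      \<longlongrightarrow> up * (LINT x|lborel. \<psi> x) + (um - up) * ?K 0) (at_right 0)"
    by (intro tendsto_add tendsto_diff tendsto_mult_right tendsto_mult exp_at_right_0 K)
  ultimately show "((\<lambda>t. (LINT x|lborel. two_states X (\<lambda>_. vm) (\<lambda>_. vp) (x, t) * \<psi> x) + w t * \<psi> (X t))
           \<longlongrightarrow> (LINT x|lborel. riemann_data vm vp x * \<psi> x)) (at_right 0) \<and>
        ((\<lambda>t. LINT x|lborel. two_states X (\<lambda>t. um * exp (- \<alpha> * t)) (\<lambda>t. up * exp (- \<alpha> * t)) (x, t) * \<psi> x)
           \<longlongrightarrow> (LINT x|lborel. riemann_data um up x * \<psi> x)) (at_right 0)"
    unfolding LINT_two_states[OF R(2,3)] by simp
qed

text \<open>From the limit for \<open>u\<close>, dividing by the jump isolates the integral of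
  \<open>\<psi>\<close> up to \<open>X t\<close>, which forces the limit of \<open>X\<close>.
  Subtracting the same integral from the limit for \<open>v\<close> then isolates the atom.\<close>

lemma attains_initial_dataD:
  fixes vm vp um up \<alpha> :: real
  assumes init: "attains_initial_data X w (two_states X (\<lambda>_. vm) (\<lambda>_. vp))
    (two_states X (\<lambda>t. um * exp (- \<alpha> * t)) (\<lambda>t. up * exp (- \<alpha> * t))) (riemann_data vm vp) (riemann_data um up)"
    and "um \<noteq> up"
  shows "(X \<longlongrightarrow> 0) (at_right 0)" "(w \<longlongrightarrow> 0) (at_right 0)"
proof -
  have K: "((\<lambda>t. LINT x:{..<X t}|lborel. \<psi> x) \<longlongrightarrow> (LINT x:{..<0}|lborel. \<psi> x)) (at_right 0)"
    (is "((\<lambda>t. ?K (X t)) \<longlongrightarrow> _) _")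
    and V: "((\<lambda>t. (vm - vp) * (LINT x:{..<X t}|lborel. \<psi> x) + w t * \<psi> (X t))
      \<longlongrightarrow> (vm - vp) * (LINT x:{..<0}|lborel. \<psi> x)) (at_right 0)"
    if test: "test_function UNIV \<psi>" for \<psi>
  proof -
    obtain R where R: "0 < R" "continuous_on UNIV \<psi>" "\<forall>x. R < \<bar>x\<bar> \<longrightarrow> \<psi> x = 0"
      using test by (rule test_function_realD) blast
    let ?I = "LINT x|lborel. \<psi> x"
    note lims = init[unfolded attains_initial_data_def, rule_format, OF test, unfolded LINT_two_states[OF R(2,3)]]
    note lim = lims[THEN conjunct1] lims[THEN conjunct2]
    have "((\<lambda>t. (vp * ?I + (vm - vp) * ?K (X t) + w t * \<psi> (X t)) - vp * ?I)
        \<longlongrightarrow> vp * ?I + (vm - vp) * ?K 0 - vp * ?I) (at_right 0)"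
      by (intro tendsto_diff lim tendsto_const)
    then show "((\<lambda>t. (vm - vp) * ?K (X t) + w t * \<psi> (X t)) \<longlongrightarrow> (vm - vp) * ?K 0) (at_right 0)"
      by (simp add: algebra_simps)
    have "((\<lambda>t. (up * exp (- \<alpha> * t) * ?I + (um * exp (- \<alpha> * t) - up * exp (- \<alpha> * t)) * ?K (X t)
        - up * exp (- \<alpha> * t) * ?I) / ((um - up) * exp (- \<alpha> * t)))
        \<longlongrightarrow> (up * ?I + (um - up) * ?K 0 - up * ?I) / (um - up)) (at_right 0)"
      using \<open>um \<noteq> up\<close> by (intro tendsto_divide tendsto_diff tendsto_mult_right lim exp_at_right_0) auto
    moreover have "(up * exp (- \<alpha> * t) * ?I + (um * exp (- \<alpha> * t) - up * exp (- \<alpha> * t)) * ?K (X t)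
        - up * exp (- \<alpha> * t) * ?I) / ((um - up) * exp (- \<alpha> * t)) = ?K (X t)" for t
    proof -
      have eq: "up * exp (- \<alpha> * t) * ?I + (um * exp (- \<alpha> * t) - up * exp (- \<alpha> * t)) * ?K (X t) - up * exp (- \<alpha> * t) * ?I
          = ?K (X t) * ((um - up) * exp (- \<alpha> * t))" by (simp add: algebra_simps)
      show ?thesis unfolding eq using \<open>um \<noteq> up\<close> by simp
    qed
    ultimately show "((\<lambda>t. ?K (X t)) \<longlongrightarrow> ?K 0) (at_right 0)"
      using \<open>um \<noteq> up\<close> by simp
  qed
  \<comment> \<open>The integral of a bump of radius \<open>e\<close> up to \<open>c\<close> is 0
    for \<open>c \<le> - e\<close> and maximal for \<open>c \<ge> e\<close>, while its value at
    \<open>c = 0\<close> lies strictly between. Convergence to that value excludes both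
    ranges.\<close>
  have "\<forall>\<^sub>F t in at_right 0. \<bar>X t\<bar> < e" if e: "0 < e" for e
  proof -
    define f where "f = bump 0 e"
    have cont: "continuous_on S f" for S
      unfolding f_def by (rule continuous_bump)
    have f0: "f x = 0" if "e \<le> \<bar>x\<bar>" for x
      using bump_eq_0[OF e, of x 0] that by (simp add: f_def)
    then have f0': "f x = 0" if "e < \<bar>x\<bar>" for x
      using that by simp
    have int: "integral {p..q} f > 0" if "p < q" "x \<in> {p..q}" "\<bar>x\<bar> < e" for p q x
    proof -
      have "integral {p..q} f \<noteq> 0"
        using integral_eq_0_iff[OF cont \<open>p < q\<close>] bump_nonneg[of 0 e] bump_pos_iff[OF e, of 0 x] that
        unfolding f_def by force
      moreover have "0 \<le> integral {p..q} f"
        by (intro Henstock_Kurzweil_Integration.integral_nonneg integrable_continuous_interval cont)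
           (simp add: f_def bump_nonneg)
      ultimately show ?thesis by simp
    qed
    have K0: "(LINT x:{..<0}|lborel. f x) = integral {-e..0} f"
      by (rule LINT_lessThan) (fact cont f0')+
    have K: "((\<lambda>t. LINT x:{..<X t}|lborel. f x) \<longlongrightarrow> integral {-e..0} f) (at_right 0)"
      using K[OF test_function_bump[OF e, of 0], folded f_def] K0 by simp
    have low: "(LINT x:{..<c}|lborel. f x) = 0" if "c \<le> - e" for c
    proof -
      have "(LINT x:{..<c}|lborel. f x) = (LINT x:{..<c}|lborel. 0)"
        unfolding set_lebesgue_integral_def
        by (intro Bochner_Integration.integral_cong) (use that f0 in \<open>auto simp: indicator_def\<close>)
      then show ?thesis by simp
    qed
    have high: "(LINT x:{..<c}|lborel. f x) = integral {-e..0} f + integral {0..e} f" if "e \<le> c" for c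
    proof -
      have "(LINT x:{..<c}|lborel. f x) = (LINT x|lborel. f x)"
        unfolding set_lebesgue_integral_def
        by (intro Bochner_Integration.integral_cong) (use that f0 in \<open>auto simp: indicator_def\<close>)
      also have "\<dots> = integral {-e..e} f"
        by (rule LINT_compact_support) (fact cont f0')+
      also have "\<dots> = integral {-e..0} f + integral {0..e} f"
        using e by (intro Henstock_Kurzweil_Integration.integral_combine[symmetric] integrable_continuous_interval cont) auto
      finally show ?thesis .
    qed
    have "0 < integral {-e..0} f" "0 < integral {0..e} f"
      using e by (auto intro: int[of _ _ 0])
    then have "\<forall>\<^sub>F t in at_right 0. 0 < (LINT x:{..<X t}|lborel. f x)"
      "\<forall>\<^sub>F t in at_right 0. (LINT x:{..<X t}|lborel. f x) < integral {-e..0} f + integral {0..e} f"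
      using order_tendstoD[OF K] by auto
    then show ?thesis
    proof eventually_elim
      case (elim t)
      then show ?case using low[of "X t"] high[of "X t"] by (cases "X t \<le> - e"; cases "e \<le> X t") auto
    qed
  qed
  then show X: "(X \<longlongrightarrow> 0) (at_right 0)"
    by (simp add: tendsto_iff dist_real_def)
  define f where "f = bump 0 1"
  have f: "0 < f 0" unfolding f_def using bump_pos_iff[of 1 0 0] by simp
  have test: "test_function UNIV f"
    unfolding f_def by (rule test_function_bump) simp
  have "isCont f 0"
    using continuous_bump[of UNIV 0 1] unfolding f_def by (simp add: continuous_on_eq_continuous_at)
  note fX = isCont_tendsto_compose[OF this X]
  let ?K = "\<lambda>c. LINT x:{..<c}|lborel. f x"
  \<comment> \<open>Division by \<open>f (X t)\<close> is safe near 0, where it tends to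
    \<open>f 0 > 0\<close>.\<close>
  have "((\<lambda>t. (((vm - vp) * ?K (X t) + w t * f (X t)) - (vm - vp) * ?K (X t)) / f (X t))
      \<longlongrightarrow> ((vm - vp) * ?K 0 - (vm - vp) * ?K 0) / f 0) (at_right 0)"
    using f by (intro tendsto_intros V[OF test] K[OF test] fX) auto
  then have "((\<lambda>t. w t * f (X t) / f (X t)) \<longlongrightarrow> 0) (at_right 0)"
    by simp
  moreover have "\<forall>\<^sub>F t in at_right 0. w t * f (X t) / f (X t) = w t"
    using order_tendstoD(1)[OF fX f] by eventually_elim simp
  ultimately show "(w \<longlongrightarrow> 0) (at_right 0)"
    by (rule Lim_transform_eventually)
qed

section \<open>Functions on the positive axis with limit zero at the origin\<close>

lemma eq_if_same_deriv_at_right_0: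
  fixes f g :: "real \<Rightarrow> real"
  assumes f: "\<And>t. 0 < t \<Longrightarrow> (f has_real_derivative h t) (at t)" "(f \<longlongrightarrow> 0) (at_right 0)"
    and g: "\<And>t. 0 < t \<Longrightarrow> (g has_real_derivative h t) (at t)" "(g \<longlongrightarrow> 0) (at_right 0)"
    and "0 < t"
  shows "f t = g t"
proof -
  have "((\<lambda>t. f t - g t) has_real_derivative 0) (at s within {0<..})" if "s \<in> {0<..}" for s
    using DERIV_diff[OF f(1) g(1), of s] that by (auto intro: has_field_derivative_at_within)
  then obtain c where c: "\<And>s. 0 < s \<Longrightarrow> f s - g s = c"
    using has_field_derivative_zero_constant[of "{0<..}" "\<lambda>t. f t - g t"] by auto
  have "((\<lambda>t. f t - g t) \<longlongrightarrow> 0 - 0) (at_right 0)"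
    by (intro tendsto_diff f g)
  moreover have "\<forall>\<^sub>F s in at_right 0. f s - g s = c"
    using c by (auto simp: eventually_at_filter)
  ultimately have "((\<lambda>_. c) \<longlongrightarrow> 0) (at_right (0::real))"
    using Lim_transform_eventually by fastforce
  then have "c = 0"
    by (simp add: tendsto_const_iff)
  then show ?thesis using c[OF \<open>0 < t\<close>] by simp
qed

lemma pos_if_deriv_pos_at_right_0:
  fixes f :: "real \<Rightarrow> real"
  assumes f: "\<And>t. 0 < t \<Longrightarrow> (f has_real_derivative f' t) (at t)" "\<And>t. 0 < t \<Longrightarrow> 0 < f' t"
    and lim: "(f \<longlongrightarrow> 0) (at_right 0)" and "0 < t"
  shows "0 < f t"
proof -
  have less: "f s < f r" if "0 < s" "s < r" for s r
    using that f by (intro DERIV_pos_imp_increasing[OF that(2)]) (meson order_less_le_trans)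
  have "\<forall>\<^sub>F s in at_right 0. s < t / 2"
    using \<open>0 < t\<close> eventually_at_right_less order_tendstoD(2)[OF tendsto_ident_at, of 0 "t/2"] by auto
  then have "\<forall>\<^sub>F s in at_right 0. f s \<le> f (t / 2)"
    using eventually_at_right_less[of 0] by eventually_elim (auto intro: less_imp_le[OF less])
  \<comment> \<open>The limit yields only a weak inequality; the step from \<open>t / 2\<close> to
    \<open>t\<close> restores strictness.\<close>
  then have "0 \<le> f (t / 2)"
    using tendsto_upperbound[OF lim] by simp
  also have "f (t / 2) < f t"
    using \<open>0 < t\<close> by (intro less) auto
  finally show ?thesis .
qed

lemma essentially_bounded_two_states:
  assumes X: "continuous_on UNIV X" and l: "continuous_on UNIV l" and r: "continuous_on UNIV r"
    and bd: "\<And>t. 0 < t \<Longrightarrow> \<bar>l t\<bar> \<le> C" "\<And>t. 0 < t \<Longrightarrow> \<bar>r t\<bar> \<le> C"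
  shows "essentially_bounded_on half_plane (two_states X l r)"
proof -
  have snd: "(\<lambda>z. f (snd z)) \<in> borel_measurable borel" if "continuous_on UNIV f" for f :: "real \<Rightarrow> real"
    by (intro borel_measurable_continuous_onI continuous_on_compose2[OF that] continuous_intros) auto
  note [measurable] = snd[OF X] snd[OF l] snd[OF r]
  have [measurable]: "(fst :: real \<times> real \<Rightarrow> real) \<in> borel_measurable borel"
    by (intro borel_measurable_continuous_onI continuous_intros)
  have "two_states X l r = (\<lambda>z. if fst z < X (snd z) then l (snd z) else r (snd z))"
    by (auto simp: two_states_def)
  then have [measurable]: "two_states X l r \<in> borel_measurable borel"
    by simp
  have "half_plane \<in> sets borel"
    by (intro borel_open open_Times) auto
  then have "set_borel_measurable lborel half_plane (two_states X l r)"
    by (simp add: set_borel_measurable_def)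
  moreover have "\<bar>two_states X l r z\<bar> \<le> C" if "z \<in> half_plane" for z
    using that bd by (auto simp: two_states_def)
  ultimately show ?thesis
    unfolding essentially_bounded_on_def by auto
qed

section \<open>Existence and uniqueness of the delta shock\<close>

text \<open>For odd \<open>k\<close> the power is strictly increasing on the whole line, so the
  entropy condition places \<open>ud\<close> between \<open>up\<close> and \<open>um\<close>
  whatever their signs.\<close>

lemma odd_power_less_iff:
  fixes x y :: real
  assumes "odd k"
  shows "x ^ k < y ^ k \<longleftrightarrow> x < y"
  using assms by (metis linorder_not_less odd_real_root_power_cancel power_mono_odd real_root_le_iff odd_pos order_le_less)

text \<open>Eliminating \<open>\<sigma>\<close> and \<open>w0\<close> leaves one equation for \<open>ud\<close>, whose left-hand side decreases
  and whose right-hand side increases on \<open>[up, um]\<close>.\<close>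
lemma entropic_rankine_hugoniot_iff:
  assumes "odd k"
  shows "entropic_rankine_hugoniot k vm vp um up \<sigma> w0 ud \<longleftrightarrow>
    up < ud \<and> ud < um \<and> \<sigma> = ud ^ k \<and> w0 = - \<sigma> * (vm - vp) + (vm * um ^ k - vp * up ^ k) \<and>
    vm * (um ^ k - ud ^ k) * (um - ud) = vp * (ud ^ k - up ^ k) * (ud - up)"
proof -
  have "(- \<sigma> * (vm - vp) + (vm * um ^ k - vp * up ^ k)) * ud
        = - \<sigma> * (vm * um - vp * up) + (vm * um ^ (k + 1) - vp * up ^ (k + 1))
      \<longleftrightarrow> vm * (um ^ k - \<sigma>) * (um - ud) = vp * (\<sigma> - up ^ k) * (ud - up)"
    by (simp add: algebra_simps) linarith
  then show ?thesis
    using odd_power_less_iff[OF assms] by (auto simp: entropic_rankine_hugoniot_def)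
qed

lemma entropic_rankine_hugoniot_ex1:
  fixes vm vp um up :: real
  assumes "odd k" "0 < vm" "0 < vp" "up < um"
  obtains \<sigma> w0 ud where "entropic_rankine_hugoniot k vm vp um up \<sigma> w0 ud"
    and "\<And>\<sigma>' w0' ud'. entropic_rankine_hugoniot k vm vp um up \<sigma>' w0' ud' \<Longrightarrow> \<sigma>' = \<sigma> \<and> w0' = w0 \<and> ud' = ud"
proof -
  note less = odd_power_less_iff[OF assms(1)]
  \<comment> \<open>Right-hand side minus left-hand side of the reduced equation for
    \<open>ud\<close>.\<close>
  define f where "f u = vp * (u ^ k - up ^ k) * (u - up) - vm * (um ^ k - u ^ k) * (um - u)" for u
  have "f up \<le> 0" "0 \<le> f um"
    using assms less[of up um] by (auto simp: f_def intro!: mult_nonneg_nonneg)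
  moreover have "continuous_on {up..um} f"
    unfolding f_def by (intro continuous_intros)
  ultimately obtain u where u: "up \<le> u" "u \<le> um" "f u = 0"
    using IVT'[of f up 0 um] assms(4) by auto
  have "f up < 0" "0 < f um"
    using assms less[of up um] by (auto simp: f_def intro!: mult_pos_pos)
  with u have u': "up < u" "u < um"
    by (metis order_le_less less_irrefl)+
  \<comment> \<open>Strictly inside the interval all factors are positive, so products of increasing
    factors increase and products of decreasing ones decrease.\<close>
  have mono: "f x < f y" if "up < x" "x < y" "y < um" for x y
  proof -
    have "x ^ k < y ^ k" "up ^ k < x ^ k" "y ^ k < um ^ k" using that less by auto
    then have "vp * (x ^ k - up ^ k) * (x - up) < vp * (y ^ k - up ^ k) * (y - up)"
      "vm * (um ^ k - y ^ k) * (um - y) < vm * (um ^ k - x ^ k) * (um - x)"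
      using that assms by (auto intro!: mult_strict_mono)
    then show ?thesis by (simp add: f_def)
  qed
  have uniq: "v = u" if "up < v" "v < um" "f v = 0" for v
    using mono[of u v] mono[of v u] that u' u(3) by (cases u v rule: linorder_cases) auto
  show ?thesis
  proof (rule that)
    show "entropic_rankine_hugoniot k vm vp um up (u ^ k) (- (u ^ k) * (vm - vp) + (vm * um ^ k - vp * up ^ k)) u"
      using u' u(3) unfolding entropic_rankine_hugoniot_iff[OF assms(1)] f_def by auto
    show "\<sigma>' = u ^ k \<and> w0' = - (u ^ k) * (vm - vp) + (vm * um ^ k - vp * up ^ k) \<and> ud' = u"
      if "entropic_rankine_hugoniot k vm vp um up \<sigma>' w0' ud'" for \<sigma>' w0' ud'
      using that uniq[of ud'] unfolding entropic_rankine_hugoniot_iff[OF assms(1)] f_def by auto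
  qed
qed

section \<open>Damped profiles and the conditions with a common exponential factor\<close>

lemma power_mult_exp: "(u * exp (- \<alpha> * t)) ^ k = u ^ k * exp (- \<alpha> * real k * t)" for u \<alpha> t :: real
  by (simp add: power_mult_distrib exp_of_nat_mult[symmetric] mult_ac)

lemma damped_profile_deriv:
  assumes "\<alpha> > 0" "0 < k"
  shows "(damped_profile k \<alpha> c has_real_derivative c * exp (- \<alpha> * real k * t)) (at t)"
  unfolding damped_profile_def[abs_def] using assms by (auto intro!: derivative_eq_intros)

lemma smooth_on_damped_profile: "smooth_on S (damped_profile k \<alpha> c)"
proof (rule smooth_on_real_coinduct[where F = "{\<lambda>t. p + q * exp (- \<alpha> * real k * t) |p q. True}"])
  have "damped_profile k \<alpha> c = (\<lambda>t. c / (\<alpha> * real k) + (- c / (\<alpha> * real k)) * exp (- \<alpha> * real k * t))"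
    by (simp add: damped_profile_def[abs_def] right_diff_distrib)
  then show "damped_profile k \<alpha> c \<in> {\<lambda>t. p + q * exp (- \<alpha> * real k * t) |p q. True}"
    by blast
  fix f assume "f \<in> {\<lambda>t. p + q * exp (- \<alpha> * real k * t) |p q. True}"
  then obtain p q where f: "f = (\<lambda>t. p + q * exp (- \<alpha> * real k * t))" by blast
  have "(f has_real_derivative 0 + (q * (- \<alpha> * real k)) * exp (- \<alpha> * real k * t)) (at t)" for t
    unfolding f by (auto intro!: derivative_eq_intros)
  then show "\<exists>f'\<in>{\<lambda>t. p + q * exp (- \<alpha> * real k * t) |p q. True}. \<forall>t. (f has_real_derivative f' t) (at t)"
    by (intro bexI[where x = "\<lambda>t. 0 + (q * (- \<alpha> * real k)) * exp (- \<alpha> * real k * t)"]) blast+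
qed

lemma damped_profile_at_0: "(damped_profile k \<alpha> c \<longlongrightarrow> 0) (at_right 0)"
proof -
  have "isCont (damped_profile k \<alpha> c) 0"
    unfolding damped_profile_def[abs_def] by (intro continuous_intros)
  then have "(damped_profile k \<alpha> c \<longlongrightarrow> damped_profile k \<alpha> c 0) (at 0)"
    by (simp add: isCont_def)
  then have "(damped_profile k \<alpha> c \<longlongrightarrow> damped_profile k \<alpha> c 0) (at_right 0)"
    by (rule tendsto_within_subset) simp
  then show ?thesis
    by (simp add: damped_profile_def)
qed

lemma smooth_on_real_deriv:
  fixes X :: "real \<Rightarrow> real"
  assumes "smooth_on {0<..} X"
  shows "\<And>t. 0 < t \<Longrightarrow> (X has_real_derivative deriv X t) (at t)" "continuous_on {0<..} (deriv X)"
proof -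
  have Ck: "Ck_on (Suc 0) {0<..} X"
    using assms unfolding smooth_on_def by blast
  have D: "(X has_real_derivative deriv X t) (at t)" if "0 < t" for t
    using Ck that by (simp add: field_differentiable_derivI field_differentiable_def real_differentiable_def)
  have "frechet_derivative X (at t) 1 = deriv X t" if "0 < t" for t
    using frechet_derivative_at[OF D[OF that, unfolded has_field_derivative_def], symmetric] by simp
  moreover have "continuous_on {0<..} (\<lambda>t. frechet_derivative X (at t) 1)"
    using Ck by simp
  ultimately have "continuous_on {0<..} (deriv X)"
    by (simp cong: continuous_on_cong_simp)
  with D show "\<And>t. 0 < t \<Longrightarrow> (X has_real_derivative deriv X t) (at t)" "continuous_on {0<..} (deriv X)"
    by blast+
qed

text \<open>In terms of \<open>E = exp (- \<alpha> * t)\<close> the momentum condition carries one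
  factor \<open>E\<close> more than the mass condition. Cancelling it leaves \<open>E ^ k\<close> as
  the only exponential, which has the decay rate of the damped profiles.\<close>

lemma jump_conditions_iff:
  "jump_conditions k \<alpha> vm vp um up X' w w' ud t \<longleftrightarrow>
    (let e = exp (- \<alpha> * real k * t) in
      w' t = vm * um ^ k * e - vp * up ^ k * e - (vm - vp) * X' t \<and>
      w t * (ud ^ k * e) = w t * X' t \<and>
      w' t * ud = (vm * um ^ (k + 1) - vp * up ^ (k + 1)) * e - (vm * um - vp * up) * X' t)"
proof -
  define E where "E = exp (- \<alpha> * t)"
  have E: "E \<noteq> 0" by (simp add: E_def)
  have e: "exp (- \<alpha> * real k * t) = E ^ k"
    using power_mult_exp[of 1 \<alpha> t k] by (simp add: E_def)
  have "w' t * (ud * E) = vm * (um * E) ^ (k + 1) - vp * (up * E) ^ (k + 1) - (vm * (um * E) - vp * (up * E)) * X' t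
    \<longleftrightarrow> w' t * ud * E = ((vm * um ^ (k + 1) - vp * up ^ (k + 1)) * E ^ k - (vm * um - vp * up) * X' t) * E"
    by (simp add: power_mult_distrib algebra_simps)
  also have "\<dots> \<longleftrightarrow> w' t * ud = (vm * um ^ (k + 1) - vp * up ^ (k + 1)) * E ^ k - (vm * um - vp * up) * X' t"
    using E by simp
  finally have third: "w' t * (ud * E) = vm * (um * E) ^ (k + 1) - vp * (up * E) ^ (k + 1) - (vm * (um * E) - vp * (up * E)) * X' t
    \<longleftrightarrow> w' t * ud = (vm * um ^ (k + 1) - vp * up ^ (k + 1)) * E ^ k - (vm * um - vp * up) * X' t" .
  show ?thesis
    unfolding jump_conditions_def Let_def e E_def[symmetric] third
    unfolding power_mult_distrib mult.assoc ..
qed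

lemma entropic_curve_iff:
  assumes "\<And>t. 0 < t \<Longrightarrow> (X has_real_derivative X' t) (at t)"
  shows "entropic_curve k \<alpha> um up X \<longleftrightarrow>
    (\<forall>t>0. up ^ k * exp (- \<alpha> * real k * t) < X' t \<and> X' t < um ^ k * exp (- \<alpha> * real k * t))"
proof -
  have "deriv X t = X' t" if "0 < t" for t
    using assms[OF that] by (rule DERIV_imp_deriv)
  then show ?thesis
    unfolding entropic_curve_def power_mult_exp by simp
qed

text \<open>With \<open>X' = \<sigma> * e\<close> and \<open>w' = w0 * e\<close> for
  \<open>e = exp (- \<alpha> * real k * t)\<close>, the jump conditions are the Rankine-Hugoniot
  relations multiplied by \<open>e\<close>.\<close>

lemma single_delta_shock_solution_damped:
  assumes "0 < \<alpha>" "0 < k" and rh: "entropic_rankine_hugoniot k vm vp um up \<sigma> w0 ud"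
  shows "single_delta_shock_solution k \<alpha> vm vp um up (damped_profile k \<alpha> \<sigma>) (damped_profile k \<alpha> w0) ud"
proof -
  let ?X = "damped_profile k \<alpha> \<sigma>" and ?w = "damped_profile k \<alpha> w0"
  let ?e = "\<lambda>t. exp (- \<alpha> * real k * t)"
  note D = damped_profile_deriv[OF assms(1,2)]
  have cont: "continuous_on S (\<lambda>t. c * ?e t)" for c S
    by (intro continuous_intros)
  have contX: "continuous_on UNIV ?X"
    using D by (auto intro!: continuous_at_imp_continuous_on DERIV_isCont)
  have C1: "?w C1_differentiable_on {0<..}"
    unfolding C1_differentiable_on_def
    using D cont by (intro exI[of _ "\<lambda>t. w0 * ?e t"]) (auto simp: has_real_derivative_iff_has_vector_derivative)
  \<comment> \<open>The rate \<open>c = 0\<close> serves \<open>v\<close>, and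
    \<open>c = \<alpha>\<close> serves \<open>u\<close>.\<close>
  have bd: "essentially_bounded_on half_plane (two_states ?X (\<lambda>t. p * exp (- c * t)) (\<lambda>t. q * exp (- c * t)))"
    if "0 \<le> c" for p q c
  proof (rule essentially_bounded_two_states[OF contX])
    have "\<bar>u * exp (- c * t)\<bar> \<le> \<bar>u\<bar>" if "0 < t" for u t
      using that \<open>0 \<le> c\<close> mult_left_mono[of "exp (- c * t)" 1 "\<bar>u\<bar>"] by (simp add: abs_mult)
    then show "\<bar>p * exp (- c * t)\<bar> \<le> \<bar>p\<bar> + \<bar>q\<bar>" "\<bar>q * exp (- c * t)\<bar> \<le> \<bar>p\<bar> + \<bar>q\<bar>" if "0 < t" for t
      using that by (metis abs_ge_zero add_increasing2 add_increasing)+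
  qed (intro continuous_intros)+
  have jump: "jump_conditions k \<alpha> vm vp um up (\<lambda>t. \<sigma> * ?e t) ?w (\<lambda>t. w0 * ?e t) ud t" for t
  proof -
    have \<sigma>: "\<sigma> = ud ^ k"
      and w0': "w0 = - \<sigma> * (vm - vp) + (vm * um ^ k - vp * up ^ k)"
      and w0ud': "w0 * ud = - \<sigma> * (vm * um - vp * up) + (vm * um ^ (k + 1) - vp * up ^ (k + 1))"
      using rh unfolding entropic_rankine_hugoniot_def by blast+
    have w0: "w0 = vm * um ^ k - vp * up ^ k - (vm - vp) * \<sigma>"
      and w0ud: "w0 * ud = vm * um ^ (k + 1) - vp * up ^ (k + 1) - (vm * um - vp * up) * \<sigma>"
      unfolding w0ud' by (simp_all add: w0')
    have "w0 * ?e t * ud = w0 * ud * ?e t"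
      by (simp only: mult_ac)
    also have "\<dots> = (vm * um ^ (k + 1) - vp * up ^ (k + 1)) * ?e t - (vm * um - vp * up) * (\<sigma> * ?e t)"
      unfolding w0ud by (simp only: left_diff_distrib mult.assoc)
    finally have "w0 * ?e t * ud = (vm * um ^ (k + 1) - vp * up ^ (k + 1)) * ?e t - (vm * um - vp * up) * (\<sigma> * ?e t)" .
    moreover have "w0 * ?e t = vm * um ^ k * ?e t - vp * up ^ k * ?e t - (vm - vp) * (\<sigma> * ?e t)"
      unfolding w0 by (simp only: left_diff_distrib mult.assoc)
    ultimately show ?thesis
      unfolding jump_conditions_iff Let_def \<sigma>[symmetric] by blast
  qed
  have weak: "\<forall>t>0. jump_conditions k \<alpha> vm vp um up (\<lambda>t. \<sigma> * ?e t) ?w (\<lambda>t. w0 * ?e t) ud t"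
    using jump by blast
  show ?thesis
    unfolding single_delta_shock_solution_def delta_shock_solution_def
  proof (intro conjI)
    show "smooth_on {0<..} ?X" by (rule smooth_on_damped_profile)
    show "continuous_on {0<..} (\<lambda>t. ud * exp (- \<alpha> * t))" by (intro continuous_intros)
    show "essentially_bounded_on half_plane (two_states ?X (\<lambda>_. vm) (\<lambda>_. vp))"
      using bd[of 0] by simp
    show "essentially_bounded_on half_plane (two_states ?X (\<lambda>t. um * exp (- \<alpha> * t)) (\<lambda>t. up * exp (- \<alpha> * t)))"
      using bd[of \<alpha>] assms(1) by simp
    show "attains_initial_data ?X ?w (two_states ?X (\<lambda>_. vm) (\<lambda>_. vp))
        (two_states ?X (\<lambda>t. um * exp (- \<alpha> * t)) (\<lambda>t. up * exp (- \<alpha> * t))) (riemann_data vm vp) (riemann_data um up)"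
      by (intro attains_initial_dataI damped_profile_at_0)
  qed (use C1 weak weak_form_iff_jump_conditions[OF D cont D cont] in blast)+
qed

lemma single_delta_shock_solution_unique:
  assumes "0 < \<alpha>" "0 < k" "0 < vm" "0 < vp" "up < um"
    and sol: "single_delta_shock_solution k \<alpha> vm vp um up X w ud"
    and entropy: "entropic_curve k \<alpha> um up X"
  obtains \<sigma> w0 where "entropic_rankine_hugoniot k vm vp um up \<sigma> w0 ud"
    and "\<And>t. 0 < t \<Longrightarrow> X t = damped_profile k \<alpha> \<sigma> t" and "\<And>t. 0 < t \<Longrightarrow> w t = damped_profile k \<alpha> w0 t"
proof -
  let ?e = "\<lambda>t. exp (- \<alpha> * real k * t)"
  have X: "(X has_real_derivative deriv X t) (at t)" if "0 < t" for t
    using sol that unfolding single_delta_shock_solution_def delta_shock_solution_def by (blast intro: smooth_on_real_deriv)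
  have contX': "continuous_on {0<..} (deriv X)"
    using sol unfolding single_delta_shock_solution_def delta_shock_solution_def by (blast intro: smooth_on_real_deriv)
  have "w C1_differentiable_on {0<..}"
    using sol unfolding single_delta_shock_solution_def delta_shock_solution_def by blast
  then obtain w' where w: "\<And>t. 0 < t \<Longrightarrow> (w has_real_derivative w' t) (at t)" "continuous_on {0<..} w'"
    by (auto simp: C1_differentiable_on_def has_real_derivative_iff_has_vector_derivative)
  have "\<forall>t>0. jump_conditions k \<alpha> vm vp um up (deriv X) w w' ud t"
    by (subst weak_form_iff_jump_conditions[OF X contX' w, symmetric])
       (use sol in \<open>unfold single_delta_shock_solution_def delta_shock_solution_def, blast\<close>)+
  then have jump: "w' t = vm * um ^ k * ?e t - vp * up ^ k * ?e t - (vm - vp) * deriv X t"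
    "w t * (ud ^ k * ?e t) = w t * deriv X t"
    "w' t * ud = (vm * um ^ (k + 1) - vp * up ^ (k + 1)) * ?e t - (vm * um - vp * up) * deriv X t"
    if "0 < t" for t
    using that unfolding jump_conditions_iff Let_def by blast+
  have "attains_initial_data X w (two_states X (\<lambda>_. vm) (\<lambda>_. vp))
      (two_states X (\<lambda>t. um * exp (- \<alpha> * t)) (\<lambda>t. up * exp (- \<alpha> * t))) (riemann_data vm vp) (riemann_data um up)"
    using sol unfolding single_delta_shock_solution_def delta_shock_solution_def by blast
  then have init: "(X \<longlongrightarrow> 0) (at_right 0)" "(w \<longlongrightarrow> 0) (at_right 0)"
    using attains_initial_dataD \<open>up < um\<close> by blast+
  have entropy': "up ^ k * ?e t < deriv X t" "deriv X t < um ^ k * ?e t" if "0 < t" for t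
    using entropy that unfolding entropic_curve_def power_mult_exp by blast+
  have "0 < w' t" if "0 < t" for t
  proof -
    \<comment> \<open>The mass condition regrouped by side: mass flows into the curve from the left
      and from the right.\<close>
    have "0 < vm * (um ^ k * ?e t - deriv X t) + vp * (deriv X t - up ^ k * ?e t)"
      using entropy'[OF that] assms by (intro add_pos_pos mult_pos_pos) auto
    then show ?thesis by (simp add: jump(1)[OF that] algebra_simps)
  qed
  then have "0 < w t" if "0 < t" for t
    using pos_if_deriv_pos_at_right_0[OF w(1) _ init(2)] that by blast
  \<comment> \<open>Only now, with \<open>w t\<close> nonzero, can it be cancelled from the second
    jump condition.\<close>
  then have dX: "deriv X t = ud ^ k * ?e t" if "0 < t" for t
    using jump(2)[OF that] that by force
  define \<sigma> w0 where "\<sigma> = ud ^ k" and "w0 = - \<sigma> * (vm - vp) + (vm * um ^ k - vp * up ^ k)"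
  have dw: "w' t = w0 * ?e t" if "0 < t" for t
    using jump(1)[OF that] dX[OF that] by (simp add: \<sigma>_def w0_def algebra_simps)
  show ?thesis
  proof (rule that)
    \<comment> \<open>A single time suffices, since both sides depend on time through the same
      nonzero factor.\<close>
    have "w0 * ud * ?e 1 = (- \<sigma> * (vm * um - vp * up) + (vm * um ^ (k + 1) - vp * up ^ (k + 1))) * ?e 1"
      using jump(3)[of 1] dw[of 1] dX[of 1] unfolding \<sigma>_def by (simp add: algebra_simps)
    then have "w0 * ud = - \<sigma> * (vm * um - vp * up) + (vm * um ^ (k + 1) - vp * up ^ (k + 1))"
      by simp
    moreover have "up ^ k < \<sigma>" "\<sigma> < um ^ k"
      using entropy'[of 1] dX[of 1] by (simp_all add: \<sigma>_def)
    ultimately show "entropic_rankine_hugoniot k vm vp um up \<sigma> w0 ud"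
      by (simp add: entropic_rankine_hugoniot_def \<sigma>_def w0_def)
    fix t :: real assume t: "0 < t"
    show "X t = damped_profile k \<alpha> \<sigma> t"
      using X dX by (intro eq_if_same_deriv_at_right_0[where h = "\<lambda>t. \<sigma> * ?e t"] init damped_profile_at_0 t
          damped_profile_deriv assms) (auto simp: \<sigma>_def)
    show "w t = damped_profile k \<alpha> w0 t"
      using w(1) dw by (intro eq_if_same_deriv_at_right_0[where h = "\<lambda>t. w0 * ?e t"] init damped_profile_at_0 t
          damped_profile_deriv assms) auto
  qed
qed

theorem theorem4p1:
  fixes k :: nat and \<alpha> vm vp um up :: real
  assumes "odd k" and "\<alpha> > 0" and "vm > 0" and "vp > 0" and "um > up"
  shows "\<exists>\<sigma> w0 ud.
    entropic_rankine_hugoniot k vm vp um up \<sigma> w0 ud \<and>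
    (\<forall>\<sigma>' w0' ud'. entropic_rankine_hugoniot k vm vp um up \<sigma>' w0' ud'
       \<longrightarrow> \<sigma>' = \<sigma> \<and> w0' = w0 \<and> ud' = ud) \<and>
    single_delta_shock_solution k \<alpha> vm vp um up
      (damped_profile k \<alpha> \<sigma>) (damped_profile k \<alpha> w0) ud \<and>
    entropic_curve k \<alpha> um up (damped_profile k \<alpha> \<sigma>) \<and>
    (\<forall>X w u.
       single_delta_shock_solution k \<alpha> vm vp um up X w u \<and> entropic_curve k \<alpha> um up X
       \<longrightarrow> (\<forall>t>0. X t = damped_profile k \<alpha> \<sigma> t \<and> w t = damped_profile k \<alpha> w0 t) \<and> u = ud)"
proof -
  have k: "0 < k" using assms(1) by (rule odd_pos)
  obtain \<sigma> w0 ud where rh: "entropic_rankine_hugoniot k vm vp um up \<sigma> w0 ud"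
    and uniq: "\<And>\<sigma>' w0' ud'. entropic_rankine_hugoniot k vm vp um up \<sigma>' w0' ud' \<Longrightarrow> \<sigma>' = \<sigma> \<and> w0' = w0 \<and> ud' = ud"
    using entropic_rankine_hugoniot_ex1[OF assms(1,3-5)] by metis
  show ?thesis
  proof (intro exI conjI allI impI)
    show "entropic_curve k \<alpha> um up (damped_profile k \<alpha> \<sigma>)"
      using rh unfolding entropic_curve_iff[OF damped_profile_deriv[OF assms(2) k]]
      by (simp add: entropic_rankine_hugoniot_def)
    show "single_delta_shock_solution k \<alpha> vm vp um up (damped_profile k \<alpha> \<sigma>) (damped_profile k \<alpha> w0) ud"
      by (rule single_delta_shock_solution_damped[OF assms(2) k rh])
    fix X w u
    assume "single_delta_shock_solution k \<alpha> vm vp um up X w u \<and> entropic_curve k \<alpha> um up X"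
    then obtain \<sigma>' w0' where *: "entropic_rankine_hugoniot k vm vp um up \<sigma>' w0' u"
      "\<And>t. 0 < t \<Longrightarrow> X t = damped_profile k \<alpha> \<sigma>' t" "\<And>t. 0 < t \<Longrightarrow> w t = damped_profile k \<alpha> w0' t"
      using single_delta_shock_solution_unique[OF assms(2) k assms(3-5)] by metis
    with uniq[OF *(1)] show "u = ud" "\<And>t. 0 < t \<Longrightarrow> X t = damped_profile k \<alpha> \<sigma> t"
      "\<And>t. 0 < t \<Longrightarrow> w t = damped_profile k \<alpha> w0 t" by auto
  qed (use rh uniq in blast)+
qed

end
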